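(* Let $A$ be a commutative $\mathbb{R}$-algebra with $1$ and $M\subseteq A$ a quadratic module. Suppose $b_1,\ldots,b_t\in A$ are such that $$\Lambda_1-b_1,\ b_1-\lambda_1,\ \ldots,\ \Lambda_t-b_t,\ b_t-\lambda_t\in M$$ for some real numbers $\lambda_i\le\Lambda_i$ ($i=1,\ldots,t$), and put $\Lambda=\prod_{i=1}^t[\lambda_i,\Lambda_i]$. Then for every finitely generated $\mathbb{R}[b_1,\ldots,b_t]$-submodule $W$ of $A$ we have $$\bigcap_{r\in\Lambda}\bigl(M+J_r(W)\bigr)\subseteq M^{\ddagger}.$$ In particular, suppose $M$ is finitely generated, $M=\mathrm{QM}(f_1,\ldots,f_s)$. If all the (finitely generated) quadratic modules $M+J_r$, $r\in\Lambda$, are closed and stable with the same stability map, then $M^{\ddagger}=\overline{M}$. If all $M+J_r$, $r\in\Lambda$, are saturated and stable with the same stability map, then $M$ has the $\ddagger$-property. (Here the stability map with respect to the canonical generators $f_1,\ldots,f_s,\pm(b_1-r_1),\ldots,\pm(b_t-r_t)$ of each $M+J_r$ is meant.)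
   Context: A quadratic module in $A$ is a set $M\subseteq A$ with $M+M\subseteq M$, $1\in M$ and $a^2m\in M$ for all $a\in A$, $m\in M$. $\mathrm{QM}(f_1,\ldots,f_s)=\{\sigma_0+\sigma_1f_1+\cdots+\sigma_sf_s\mid\sigma_i \text{ sums of squares in } A\}$ is the quadratic module generated by $f_1,\ldots,f_s$; a quadratic module is finitely generated if it has this form. $\mathbb{R}[b_1,\ldots,b_t]$ is the subalgebra of $A$ generated by the $b_i$. For $r=(r_1,\ldots,r_t)\in\Lambda$ and an $\mathbb{R}[b_1,\ldots,b_t]$-submodule $W$ of $A$, $J_r(W)=\{\sum_{i=1}^t(b_i-r_i)w_i\mid w_i\in W\}$, and $J_r=J_r(A)$ is the ideal of $A$ generated by $b_1-r_1,\ldots,b_t-r_t$. For a quadratic module $M$: $M^{\ddagger}=\{f\in A\mid\exists q\in A\ \forall\varepsilon>0:\ f+\varepsilon q\in M\}$ (the sequential closure in the finest locally convex topology on $A$); $\overline{M}=M^{\vee\vee}=\{f\in A\mid L(f)\ge 0\text{ for all linear }L\colon A\to\mathbb{R}\text{ with }L(M)\subseteq\mathbb{R}_{\ge 0}\}$ (the closure of $M$ in that topology). Let $\mathcal{V}_A$ be the set of unital $\mathbb{R}$-algebra homomorphisms $A\to\mathbb{R}$, $\mathcal{S}(M)=\{\alpha\in\mathcal{V}_A\mid\alpha(M)\subseteq\mathbb{R}_{\ge 0}\}$, and $\mathrm{Pos}(Y)=\{a\in A\mid\alpha(a)\ge 0\ \forall\alpha\in Y\}$ for $Y\subseteq\mathcal{V}_A$.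 $M$ is closed if $M=M^{\vee\vee}$, saturated if $M=\mathrm{Pos}(\mathcal{S}(M))$, and has the $\ddagger$-property if $M^{\ddagger}=\mathrm{Pos}(\mathcal{S}(M))$. A quadratic module $N=\mathrm{QM}(a_1,\ldots,a_k)$ is stable if for every finite dimensional $\mathbb{R}$-subspace $U$ of $A$ there is a finite dimensional $\mathbb{R}$-subspace $V$ of $A$ with $N\cap U\subseteq\{\sigma_0+\sigma_1a_1+\cdots+\sigma_ka_k\mid\sigma_i\in\sum V^2\}$, where $\sum V^2$ is the set of finite sums of squares of elements of $V$. A map assigning to each $U$ such a $V$ is a stability map of $N$ with respect to the generators $a_1,\ldots,a_k$. "Stable with the same stability map" for all $r$ means that one map $U\mapsto V$, independent of $r$, is a stability map for all $M+J_r$ with respect to the indicated generators. *)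

theory Defs
  imports Complex_Main "HOL-Library.FuncSet" "HOL-Library.Set_Algebras"
begin

text \<open>
  A commutative unital real algebra is a type of sort
  \<open>{real_algebra, comm_ring, comm_monoid_mult}\<close>.  The class \<open>real_algebra_1\<close> is
  avoided because it excludes the zero algebra.  A real number \<open>c\<close> is identified with
  the element \<open>c *\<^sub>R 1\<close>.  Indices run from \<open>0\<close> to \<open>t - 1\<close>; the sum \<open>M + J\<close> of two sets is the
  elementwise sum of \<open>HOL-Library.Set_Algebras\<close>.
\<close>

definition quadratic_module :: "'a::{real_algebra,comm_ring,comm_monoid_mult} set \<Rightarrow> bool" where
  "quadratic_module M \<longleftrightarrow>
     M + M \<subseteq> M \<and> 1 \<in> M \<and> (\<forall>a. \<forall>m\<in>M. a\<^sup>2 * m \<in> M)"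

definition sums_of_squares :: "'a::{real_algebra,comm_ring,comm_monoid_mult} set \<Rightarrow> 'a set" where
  "sums_of_squares V = {\<Sum>v\<leftarrow>vs. v\<^sup>2 | vs. set vs \<subseteq> V}"

definition QM_over ::
    "'a::{real_algebra,comm_ring,comm_monoid_mult} set \<Rightarrow> 'a list \<Rightarrow> 'a set" where
  "QM_over V fs = {\<sigma>\<^sub>0 + (\<Sum>i<length fs. \<sigma> i * fs ! i) | \<sigma>\<^sub>0 \<sigma>.
     \<sigma>\<^sub>0 \<in> sums_of_squares V \<and> (\<forall>i<length fs. \<sigma> i \<in> sums_of_squares V)}"

definition QM :: "'a::{real_algebra,comm_ring,comm_monoid_mult} list \<Rightarrow> 'a set" where
  "QM fs = QM_over UNIV fs"

definition real_subalgebra :: "'a::{real_algebra,comm_ring,comm_monoid_mult} set \<Rightarrow> bool" where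
  "real_subalgebra R \<longleftrightarrow> subspace R \<and> 1 \<in> R \<and> (\<forall>x\<in>R. \<forall>y\<in>R. x * y \<in> R)"

definition submodule_over :: "'a::{real_algebra,comm_ring,comm_monoid_mult} set \<Rightarrow> 'a set \<Rightarrow> bool" where
  "submodule_over R W \<longleftrightarrow>
     0 \<in> W \<and> (\<forall>v\<in>W. \<forall>w\<in>W. v + w \<in> W) \<and> (\<forall>c\<in>R. \<forall>w\<in>W. c * w \<in> W)"

definition fg_submodule ::
    "'a::{real_algebra,comm_ring,comm_monoid_mult} set \<Rightarrow> 'a set \<Rightarrow> bool" where
  "fg_submodule R W \<longleftrightarrow> (\<exists>G. finite G \<and> W = submodule_over R hull G)"

definition param_box :: "nat \<Rightarrow> (nat \<Rightarrow> real) \<Rightarrow> (nat \<Rightarrow> real) \<Rightarrow> (nat \<Rightarrow> real) set" where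
  "param_box t l u = (\<Pi>\<^sub>E i\<in>{..<t}. {l i..u i})"

definition J_sub ::
    "nat \<Rightarrow> (nat \<Rightarrow> 'a) \<Rightarrow> (nat \<Rightarrow> real) \<Rightarrow> 'a set \<Rightarrow> 'a::{real_algebra,comm_ring,comm_monoid_mult} set"
  where "J_sub t b r W = {\<Sum>i<t. (b i - r i *\<^sub>R 1) * w i | w. \<forall>i<t. w i \<in> W}"

definition seq_closure :: "'a::{real_algebra,comm_ring,comm_monoid_mult} set \<Rightarrow> 'a set" where
  "seq_closure M = {f. \<exists>q. \<forall>\<epsilon>>0. f + \<epsilon> *\<^sub>R q \<in> M}"

definition double_dual :: "'a::{real_algebra,comm_ring,comm_monoid_mult} set \<Rightarrow> 'a set" where
  "double_dual M = {f. \<forall>L :: 'a \<Rightarrow> real. linear L \<and> (\<forall>m\<in>M. L m \<ge> 0) \<longrightarrow> L f \<ge> 0}"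

definition real_characters :: "('a::{real_algebra,comm_ring,comm_monoid_mult} \<Rightarrow> real) set" where
  "real_characters = {\<alpha>. linear \<alpha> \<and> \<alpha> 1 = 1 \<and> (\<forall>x y. \<alpha> (x * y) = \<alpha> x * \<alpha> y)}"

definition nonneg_characters ::
    "'a::{real_algebra,comm_ring,comm_monoid_mult} set \<Rightarrow> ('a \<Rightarrow> real) set" where
  "nonneg_characters M = {\<alpha>\<in>real_characters. \<forall>m\<in>M. \<alpha> m \<ge> 0}"

definition Pos_on :: "('a::{real_algebra,comm_ring,comm_monoid_mult} \<Rightarrow> real) set \<Rightarrow> 'a set" where
  "Pos_on Y = {a. \<forall>\<alpha>\<in>Y. \<alpha> a \<ge> 0}"

definition closed_qm :: "'a::{real_algebra,comm_ring,comm_monoid_mult} set \<Rightarrow> bool" where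
  "closed_qm M \<longleftrightarrow> M = double_dual M"

definition saturated_qm :: "'a::{real_algebra,comm_ring,comm_monoid_mult} set \<Rightarrow> bool" where
  "saturated_qm M \<longleftrightarrow> M = Pos_on (nonneg_characters M)"

definition ddagger_property :: "'a::{real_algebra,comm_ring,comm_monoid_mult} set \<Rightarrow> bool" where
  "ddagger_property M \<longleftrightarrow> seq_closure M = Pos_on (nonneg_characters M)"

definition fin_dim_subspace :: "'a::real_vector set \<Rightarrow> bool" where
  "fin_dim_subspace U \<longleftrightarrow> (\<exists>B. finite B \<and> U = span B)"

definition stability_map ::
    "'a::{real_algebra,comm_ring,comm_monoid_mult} list \<Rightarrow> ('a set \<Rightarrow> 'a set) \<Rightarrow> bool" where
  "stability_map gs \<Phi> \<longleftrightarrow>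
     (\<forall>U. fin_dim_subspace U \<longrightarrow>
        fin_dim_subspace (\<Phi> U) \<and> QM gs \<inter> U \<subseteq> QM_over (\<Phi> U) gs)"

definition canonical_gens ::
    "'a list \<Rightarrow> nat \<Rightarrow> (nat \<Rightarrow> 'a) \<Rightarrow> (nat \<Rightarrow> real) \<Rightarrow> 'a::{real_algebra,comm_ring,comm_monoid_mult} list"
  where "canonical_gens fs t b r =
    fs @ concat (map (\<lambda>i. [b i - r i *\<^sub>R 1, - (b i - r i *\<^sub>R 1)]) [0..<t])"

text \<open>The canonical generators generate \<open>M + J\<^sub>r\<close> when \<open>fs\<close> generates \<open>M\<close>.\<close>

lemma QM_snoc: "QM (fs @ [g]) = QM fs + (\<lambda>\<sigma>. \<sigma> * g) ` sums_of_squares UNIV"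
proof (intro equalityI subsetI)
  fix x assume "x \<in> QM (fs @ [g])"
  then obtain s0 s where s: "s0 \<in> sums_of_squares UNIV" "\<forall>i<Suc (length fs). s i \<in> sums_of_squares UNIV"
    "x = s0 + (\<Sum>i<Suc (length fs). s i * (fs @ [g]) ! i)"
    by (auto simp: QM_def QM_over_def)
  have "x = (s0 + (\<Sum>i<length fs. s i * fs ! i)) + s (length fs) * g"
    unfolding s(3) by (simp add: nth_append add.assoc)
  moreover have "s0 + (\<Sum>i<length fs. s i * fs ! i) \<in> QM fs"
    unfolding QM_def QM_over_def
    by (intro CollectI exI[of _ s0] exI[of _ s]) (use s in auto)
  ultimately show "x \<in> QM fs + (\<lambda>\<sigma>. \<sigma> * g) ` sums_of_squares UNIV"
    using s(2) by (auto simp: set_plus_def)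
next
  fix x assume "x \<in> QM fs + (\<lambda>\<sigma>. \<sigma> * g) ` sums_of_squares UNIV"
  then obtain s0 s z where s: "s0 \<in> sums_of_squares UNIV" "\<forall>i<length fs. s i \<in> sums_of_squares UNIV"
    "z \<in> sums_of_squares UNIV" "x = (s0 + (\<Sum>i<length fs. s i * fs ! i)) + z * g"
    by (auto simp: QM_def QM_over_def set_plus_def)
  define s' where "s' = s(length fs := z)"
  have "x = s0 + (\<Sum>i<length (fs @ [g]). s' i * (fs @ [g]) ! i)"
    unfolding s(4) by (simp add: s'_def nth_append add.assoc)
  moreover have "\<forall>i<length (fs @ [g]). s' i \<in> sums_of_squares UNIV"
    using s by (auto simp: s'_def less_Suc_eq)
  ultimately show "x \<in> QM (fs @ [g])"
    using s(1) unfolding QM_def QM_over_def by blast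
qed

lemma diff_of_squares_halves:
  fixes a :: "'a::{real_algebra,comm_ring,comm_monoid_mult}"
  shows "((1/2) *\<^sub>R (a + 1))\<^sup>2 - ((1/2) *\<^sub>R (a - 1))\<^sup>2 = a"
proof -
  have "((1/2) *\<^sub>R (a + 1))\<^sup>2 - ((1/2) *\<^sub>R (a - 1))\<^sup>2
      = (1/4 + 1/4 + 1/4 + 1/4) *\<^sub>R a"
    unfolding scaleR_left_distrib by (simp add: power2_eq_square algebra_simps)
  then show ?thesis by simp
qed

lemma QM_snoc_plus_minus: "QM (fs @ [g, - g]) = QM fs + range (\<lambda>w. g * w)"
proof -
  have "(\<lambda>\<sigma>. \<sigma> * g) ` sums_of_squares UNIV + (\<lambda>\<sigma>. \<sigma> * - g) ` sums_of_squares UNIV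
      = range (\<lambda>w. g * w)" (is "?L = _")
  proof (intro equalityI subsetI)
    fix x assume "x \<in> ?L"
    then obtain p q where "x = p * g + q * - g" by (auto simp: set_plus_def)
    then have "x = g * (p - q)" by (simp add: algebra_simps)
    then show "x \<in> range (\<lambda>w. g * w)" by blast
  next
    fix x assume "x \<in> range (\<lambda>w. g * w)"
    then obtain w where w: "x = g * w" by blast
    define p q where "p = ((1/2) *\<^sub>R (w + 1))\<^sup>2" and "q = ((1/2) *\<^sub>R (w - 1))\<^sup>2"
    have sq: "y\<^sup>2 \<in> sums_of_squares UNIV" for y :: 'a
      unfolding sums_of_squares_def by (intro CollectI exI[of _ "[y]"]) auto
    have "p * g + q * - g = g * (p - q)" by (simp add: algebra_simps)
    also have "p - q = w" unfolding p_def q_def by (rule diff_of_squares_halves)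
    finally have "x = p * g + q * - g" by (simp add: w)
    moreover have "p \<in> sums_of_squares UNIV" "q \<in> sums_of_squares UNIV"
      unfolding p_def q_def by (rule sq)+
    ultimately show "x \<in> ?L" unfolding set_plus_def by blast
  qed
  moreover have "QM (fs @ [g, - g]) = QM ((fs @ [g]) @ [- g])" by simp
  ultimately show ?thesis
    by (simp only: QM_snoc add.assoc)
qed

lemma QM_canonical_gens: "QM (canonical_gens fs t b r) = QM fs + J_sub t b r UNIV"
proof (induction t)
  case 0
  show ?case by (simp add: canonical_gens_def J_sub_def set_plus_def)
next
  case (Suc t)
  let ?g = "b t - r t *\<^sub>R 1"
  have "J_sub (Suc t) b r UNIV = J_sub t b r UNIV + range (\<lambda>w. ?g * w)" (is "?L = ?R")
  proof (intro equalityI subsetI)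
    fix x assume "x \<in> ?L"
    then show "x \<in> ?R" by (auto simp: J_sub_def set_plus_def)
  next
    fix x assume "x \<in> ?R"
    then obtain w v where "x = (\<Sum>i<t. (b i - r i *\<^sub>R 1) * w i) + ?g * v"
      by (auto simp: J_sub_def set_plus_def)
    then have "x = (\<Sum>i<Suc t. (b i - r i *\<^sub>R 1) * (w(t := v)) i)" by simp
    then show "x \<in> ?L" unfolding J_sub_def by blast
  qed
  moreover have "canonical_gens fs (Suc t) b r = canonical_gens fs t b r @ [?g, - ?g]"
    by (simp add: canonical_gens_def)
  ultimately show ?case
    by (simp only: QM_snoc_plus_minus Suc.IH add.assoc)
qed

end

theory Submission
  imports Defs "HOL-Analysis.Analysis"
begin

text \<open>
  Write \<open>B = \<real>[b\<^sub>1, \<dots>, b\<^sub>t]\<close> and let \<open>G\<close> be a finite set generating \<open>W\<close>.  If \<open>f\<close> lies in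
  \<open>M + J\<^sub>r(W)\<close> for every \<open>r\<close> in the box, then for each \<open>r\<close> it has the form \<open>f = s\<^sub>r + \<Sum>\<^sub>a g\<^sub>r\<^sub>a a\<close>
  with \<open>s\<^sub>r \<in> M\<close>, \<open>a\<close> running through \<open>G\<close>, and coefficients \<open>g\<^sub>r\<^sub>a \<in> B\<close> that vanish at \<open>r\<close> and
  hence are small near \<open>r\<close>.  Multiplying by a polynomial approximation \<open>\<Sum>\<^sub>r e\<^sub>r\<^sup>2\<close> of a partition
  of unity on the compact box, with \<open>e\<^sub>r\<close> concentrated near \<open>r\<close>, gives
  \<open>f = \<Sum>\<^sub>r e\<^sub>r\<^sup>2 s\<^sub>r + d f + \<Sum>\<^sub>a h\<^sub>a a\<close>, where \<open>d\<close> and all \<open>h\<^sub>a\<close> are elements of \<open>B\<close> whose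
  polynomial functions are less than \<open>\<epsilon>\<close> in absolute value on the box.

  Since \<open>M\<close> bounds the \<open>b\<^sub>i\<close>, a Positivstellensatz (\<open>positive_on_box_mem\<close>) converts this
  smallness into \<open>\<epsilon> \<plusminus> h\<^sub>a \<in> M\<close>, and likewise for \<open>d\<close>.  Then \<open>h\<^sub>a a + \<epsilon> (a\<^sup>2 + 1) \<in> M\<close>
  (\<open>absorb_small_multiple\<close>), and together \<open>f + \<epsilon> q \<in> M\<close> with \<open>q = f\<^sup>2 + 1 + \<Sum>\<^sub>a (a\<^sup>2 + 1)\<close>,
  an element that does not depend on \<open>\<epsilon>\<close> (\<open>glue_fibres\<close>).

  The Positivstellensatz is proved in the style of Kadison and Dubois: a proper module over the
  squares of \<open>B\<close> extends to a maximal one by Zorn's lemma, a maximal one is total on bounded elements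
  and therefore determines a point of the box (\<open>evaluation_point\<close>), and a strictly positive \<open>h\<close>
  cannot be negative there.  A classical identity then improves \<open>\<sigma> h \<ge> 1\<close> to \<open>h \<ge> 0\<close>.

  For the two consequences, an element of \<open>double_dual M\<close> or of the saturation of \<open>M\<close> belongs to
  every \<open>M + J\<^sub>r\<close> because these modules contain \<open>M\<close> and are closed or saturated.  A common
  stability map bounds the ideal parts of its representations by a single finitely generated \<open>W\<close>
  (\<open>fibrewise_member_in_seq_closure\<close>), so the first part applies.
\<close>

section \<open>Polynomial expressions in the bounded elements\<close>

text \<open>
  \<open>poly_expr t b h \<phi>\<close> says that some real polynomial \<open>p\<close> in \<open>t\<close> variables satisfies
  \<open>h = p(b)\<close> and has \<open>\<phi>\<close> as its polynomial function.  Keeping the pair avoids a formal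
  polynomial ring: \<open>\<phi>\<close> need not be determined by \<open>h\<close>, since the \<open>b i\<close> may satisfy algebraic
  relations, but every argument below only has to carry along one suitable \<open>\<phi>\<close>.
\<close>

inductive poly_expr ::
  "nat \<Rightarrow> (nat \<Rightarrow> 'a::{real_algebra,comm_ring,comm_monoid_mult}) \<Rightarrow> 'a \<Rightarrow> ((nat \<Rightarrow> real) \<Rightarrow> real) \<Rightarrow> bool"
  for t b where
  poly_const: "poly_expr t b (c *\<^sub>R 1) (\<lambda>_. c)"
| poly_var: "i < t \<Longrightarrow> poly_expr t b (b i) (\<lambda>x. x i)"
| poly_add: "poly_expr t b g \<gamma> \<Longrightarrow> poly_expr t b h \<phi> \<Longrightarrow> poly_expr t b (g + h) (\<lambda>x. \<gamma> x + \<phi> x)"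
| poly_mult: "poly_expr t b g \<gamma> \<Longrightarrow> poly_expr t b h \<phi> \<Longrightarrow> poly_expr t b (g * h) (\<lambda>x. \<gamma> x * \<phi> x)"

definition poly_values ::
  "nat \<Rightarrow> (nat \<Rightarrow> 'a::{real_algebra,comm_ring,comm_monoid_mult}) \<Rightarrow> 'a set" where
  "poly_values t b = {h. \<exists>\<phi>. poly_expr t b h \<phi>}"

lemma poly_expr_scale:
  assumes "poly_expr t b h \<phi>"
  shows "poly_expr t b (c *\<^sub>R h) (\<lambda>x. c * \<phi> x)"
  using poly_mult[OF poly_const[of t b c] assms] by simp

lemma poly_expr_minus:
  assumes "poly_expr t b h \<phi>"
  shows "poly_expr t b (- h) (\<lambda>x. - \<phi> x)"
  using poly_expr_scale[OF assms, of "-1"] by simp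

lemma poly_expr_diff:
  assumes "poly_expr t b g \<gamma>" "poly_expr t b h \<phi>"
  shows "poly_expr t b (g - h) (\<lambda>x. \<gamma> x - \<phi> x)"
  using poly_add[OF assms(1) poly_expr_minus[OF assms(2)]] by simp

lemma poly_expr_one: "poly_expr t b 1 (\<lambda>_. 1)"
  using poly_const[of t b 1] by simp

lemma poly_expr_sum:
  assumes "finite I" "\<And>i. i \<in> I \<Longrightarrow> poly_expr t b (h i) (\<phi> i)"
  shows "poly_expr t b (\<Sum>i\<in>I. h i) (\<lambda>x. \<Sum>i\<in>I. \<phi> i x)"
  using assms
proof (induction I)
  case empty
  show ?case using poly_const[of t b 0] by simp
next
  case (insert i I)
  then have "poly_expr t b (h i + sum h I) (\<lambda>x. \<phi> i x + (\<Sum>i\<in>I. \<phi> i x))"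
    by (intro poly_add) auto
  then show ?case using insert.hyps by simp
qed

lemma poly_expr_square:
  "poly_expr t b h \<phi> \<Longrightarrow> poly_expr t b (h\<^sup>2) (\<lambda>x. (\<phi> x)\<^sup>2)"
  unfolding power2_eq_square by (rule poly_mult)

lemma const_in_poly_values: "c *\<^sub>R 1 \<in> poly_values t b"
  unfolding poly_values_def by (intro CollectI exI) (rule poly_const)

lemma one_in_poly_values: "1 \<in> poly_values t b"
  using const_in_poly_values[of 1] by simp

lemma zero_in_poly_values: "0 \<in> poly_values t b"
  using const_in_poly_values[of 0] by simp

lemma poly_values_add:
  "x \<in> poly_values t b \<Longrightarrow> y \<in> poly_values t b \<Longrightarrow> x + y \<in> poly_values t b"
  unfolding poly_values_def by (blast intro: poly_add)

lemma poly_values_mult: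
  "x \<in> poly_values t b \<Longrightarrow> y \<in> poly_values t b \<Longrightarrow> x * y \<in> poly_values t b"
  unfolding poly_values_def by (blast intro: poly_mult)

lemma poly_values_diff:
  "x \<in> poly_values t b \<Longrightarrow> y \<in> poly_values t b \<Longrightarrow> x - y \<in> poly_values t b"
  unfolding poly_values_def by (blast intro: poly_expr_diff)

lemma poly_values_scale: "x \<in> poly_values t b \<Longrightarrow> c *\<^sub>R x \<in> poly_values t b"
  unfolding poly_values_def by (blast intro: poly_expr_scale)

lemma poly_values_square: "x \<in> poly_values t b \<Longrightarrow> x\<^sup>2 \<in> poly_values t b"
  unfolding power2_eq_square by (rule poly_values_mult)

lemmas poly_values_closed =
  poly_values_add poly_values_diff poly_values_mult poly_values_square poly_values_scale

lemma real_subalgebra_poly_values: "real_subalgebra (poly_values t b)"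
  unfolding real_subalgebra_def subspace_def
  by (simp add: zero_in_poly_values one_in_poly_values poly_values_closed)

text \<open>
  Coefficients from the subalgebra \<open>\<real>[b\<^sub>1, \<dots>, b\<^sub>t]\<close> thus come with a polynomial function,
  which makes them accessible to analysis on the box.
\<close>

lemma real_subalgebra_hull_subset_poly_values:
  "real_subalgebra hull (b ` {..<t}) \<subseteq> poly_values t b"
proof (rule hull_minimal)
  show "b ` {..<t} \<subseteq> poly_values t b"
    unfolding poly_values_def by (blast intro: poly_var)
qed (rule real_subalgebra_poly_values)

lemma continuous_on_poly_expr:
  assumes "poly_expr t b h \<phi>"
  shows "continuous_on S \<phi>"
proof -
  have "continuous_on UNIV \<phi>"
    using assms
    by induction (auto intro: continuous_on_add continuous_on_mult)
  then show ?thesis by (rule continuous_on_subset) simp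
qed

section \<open>Sums of squares\<close>

lemma zero_in_sums_of_squares: "0 \<in> sums_of_squares V"
  unfolding sums_of_squares_def by (intro CollectI exI[of _ "[]"]) simp

lemma square_in_sums_of_squares: "v \<in> V \<Longrightarrow> v\<^sup>2 \<in> sums_of_squares V"
  unfolding sums_of_squares_def by (intro CollectI exI[of _ "[v]"]) simp

lemma sums_of_squares_add:
  assumes "\<sigma> \<in> sums_of_squares V" "\<tau> \<in> sums_of_squares V"
  shows "\<sigma> + \<tau> \<in> sums_of_squares V"
proof -
  obtain vs ws where "\<sigma> = (\<Sum>v\<leftarrow>vs. v\<^sup>2)" "set vs \<subseteq> V" "\<tau> = (\<Sum>v\<leftarrow>ws. v\<^sup>2)" "set ws \<subseteq> V"
    using assms unfolding sums_of_squares_def by blast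
  then show ?thesis
    unfolding sums_of_squares_def by (intro CollectI exI[of _ "vs @ ws"]) simp
qed

lemma sums_of_squares_induct [consumes 1, case_names zero add]:
  assumes "\<sigma> \<in> sums_of_squares V"
    and "P 0" and "\<And>v \<sigma>. v \<in> V \<Longrightarrow> \<sigma> \<in> sums_of_squares V \<Longrightarrow> P \<sigma> \<Longrightarrow> P (v\<^sup>2 + \<sigma>)"
  shows "P \<sigma>"
proof -
  obtain vs where vs: "\<sigma> = (\<Sum>v\<leftarrow>vs. v\<^sup>2)" "set vs \<subseteq> V"
    using assms unfolding sums_of_squares_def by blast
  have "set vs \<subseteq> V \<Longrightarrow> P (\<Sum>v\<leftarrow>vs. v\<^sup>2)"
  proof (induction vs)
    case (Cons v vs)
    then have "(\<Sum>v\<leftarrow>vs. v\<^sup>2) \<in> sums_of_squares V"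
      unfolding sums_of_squares_def by auto
    then show ?case using Cons assms(3) by simp
  qed (simp add: assms(2))
  then show ?thesis using vs by simp
qed

lemma square_times_sums_of_squares:
  assumes "\<sigma> \<in> sums_of_squares V" "\<And>v. v \<in> V \<Longrightarrow> a * v \<in> V"
  shows "a\<^sup>2 * \<sigma> \<in> sums_of_squares V"
  using assms(1)
proof (induction rule: sums_of_squares_induct)
  case zero
  show ?case by (simp add: zero_in_sums_of_squares)
next
  case (add v \<sigma>)
  then show ?case
    using sums_of_squares_add[OF square_in_sums_of_squares[OF assms(2)[OF add(1)]] add(3)]
    by (simp add: power_mult_distrib distrib_left)
qed

lemma sums_of_squares_subset_poly_values:
  assumes "\<sigma> \<in> sums_of_squares (poly_values t b)"
  shows "\<sigma> \<in> poly_values t b"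
  using assms
  by (induction rule: sums_of_squares_induct)
     (auto intro: poly_values_closed zero_in_poly_values)

section \<open>Modules over squares that bound the parameters\<close>

text \<open>
  The closure under squares is demanded only for elements of \<open>\<real>[b\<^sub>1, \<dots>, b\<^sub>t]\<close>: every such
  element is bounded relative to \<open>N\<close>, which is what the Positivstellensatz below
  needs, while \<open>N\<close> itself stays inside the whole algebra, so that the quadratic module \<open>M\<close>
  of the main theorem is an instance.
\<close>

locale box_module =
  fixes t :: nat and b :: "nat \<Rightarrow> 'a::{real_algebra,comm_ring,comm_monoid_mult}"
    and l u :: "nat \<Rightarrow> real" and N :: "'a set"
  assumes one: "1 \<in> N"
    and add: "m \<in> N \<Longrightarrow> n \<in> N \<Longrightarrow> m + n \<in> N"
    and square_mult: "a \<in> poly_values t b \<Longrightarrow> m \<in> N \<Longrightarrow> a\<^sup>2 * m \<in> N"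
    and upper: "i < t \<Longrightarrow> u i *\<^sub>R 1 - b i \<in> N"
    and lower: "i < t \<Longrightarrow> b i - l i *\<^sub>R 1 \<in> N"
begin

lemma sumI: "m \<in> N \<Longrightarrow> n \<in> N \<Longrightarrow> x = m + n \<Longrightarrow> x \<in> N"
  using add by simp

lemma scale:
  assumes "0 \<le> c" "m \<in> N" shows "c *\<^sub>R m \<in> N"
proof -
  have "(sqrt c *\<^sub>R 1)\<^sup>2 * m = c *\<^sub>R m" using assms(1) by (simp add: power2_eq_square)
  then show ?thesis using square_mult[OF const_in_poly_values assms(2)] by metis
qed

lemma cancel_scale: 
  assumes "0 < c" "c *\<^sub>R m \<in> N" shows "m \<in> N"
  using scale[of "1 / c" "c *\<^sub>R m"] assms by simp

lemma cancel_double_scale: "0 < c \<Longrightarrow> c *\<^sub>R m + c *\<^sub>R m \<in> N \<Longrightarrow> m \<in> N"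
  by (rule cancel_scale[of "c + c"]) (simp_all only: scaleR_left_distrib add_pos_pos)

lemma const: "0 \<le> c \<Longrightarrow> c *\<^sub>R 1 \<in> N"
  using scale one by blast

lemma square: "a \<in> poly_values t b \<Longrightarrow> a\<^sup>2 \<in> N"
  using square_mult[OF _ one] by simp

lemma sos_mult:
  assumes "\<sigma> \<in> sums_of_squares (poly_values t b)" "m \<in> N"
  shows "\<sigma> * m \<in> N"
  using assms(1)
proof (induction rule: sums_of_squares_induct)
  case zero
  show ?case using const[of 0] by simp
next
  case (add v \<sigma>)
  show ?case
    by (rule sumI[OF square_mult[OF add(1) assms(2)] add(3)]) (rule distrib_right)
qed

definition bounded_by :: "real \<Rightarrow> 'a \<Rightarrow> bool" where
  "bounded_by c x \<longleftrightarrow> c *\<^sub>R 1 - x \<in> N \<and> c *\<^sub>R 1 + x \<in> N"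

lemma bounded_by_mono:
  assumes "bounded_by c x" "c \<le> d" shows "bounded_by d x"
  unfolding bounded_by_def
proof
  show "d *\<^sub>R 1 - x \<in> N"
    by (rule sumI[of "(d - c) *\<^sub>R 1" "c *\<^sub>R 1 - x"])
       (use assms const[of "d - c"] in \<open>auto simp: bounded_by_def algebra_simps\<close>)
  show "d *\<^sub>R 1 + x \<in> N"
    by (rule sumI[of "(d - c) *\<^sub>R 1" "c *\<^sub>R 1 + x"])
       (use assms const[of "d - c"] in \<open>auto simp: bounded_by_def algebra_simps\<close>)
qed

lemma bounded_by_const: "bounded_by \<bar>c\<bar> (c *\<^sub>R 1)"
  unfolding bounded_by_def scaleR_left_diff_distrib[symmetric] scaleR_left_distrib[symmetric]
  by (auto intro!: const)

lemma bounded_by_add: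
  assumes "bounded_by c x" "bounded_by d y" shows "bounded_by (c + d) (x + y)"
  unfolding bounded_by_def
proof
  show "(c + d) *\<^sub>R 1 - (x + y) \<in> N"
    by (rule sumI[of "c *\<^sub>R 1 - x" "d *\<^sub>R 1 - y"])
       (use assms in \<open>auto simp: bounded_by_def algebra_simps\<close>)
  show "(c + d) *\<^sub>R 1 + (x + y) \<in> N"
    by (rule sumI[of "c *\<^sub>R 1 + x" "d *\<^sub>R 1 + y"])
       (use assms in \<open>auto simp: bounded_by_def algebra_simps\<close>)
qed

text \<open>
  Passing to squares turns a two-sided bound into a single membership.  Bounds for products
  then follow because the square of one factor may multiply an element of \<open>N\<close>.
\<close>

lemma bounded_by_iff_square:
  assumes "0 < c" "x \<in> poly_values t b"
  shows "bounded_by c x \<longleftrightarrow> c\<^sup>2 *\<^sub>R 1 - x\<^sup>2 \<in> N"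
proof
  assume *: "bounded_by c x"
  have "(c *\<^sub>R 1 + x)\<^sup>2 * (c *\<^sub>R 1 - x) + (c *\<^sub>R 1 - x)\<^sup>2 * (c *\<^sub>R 1 + x) \<in> N"
    using * assms(2) unfolding bounded_by_def
    by (auto intro!: add square_mult poly_values_add poly_values_diff const_in_poly_values
        simp del: scaleR_left_distrib)
  also have "(c *\<^sub>R 1 + x)\<^sup>2 * (c *\<^sub>R 1 - x) + (c *\<^sub>R 1 - x)\<^sup>2 * (c *\<^sub>R 1 + x)
      = c *\<^sub>R (c\<^sup>2 *\<^sub>R 1 - x\<^sup>2) + c *\<^sub>R (c\<^sup>2 *\<^sub>R 1 - x\<^sup>2)"
    by (simp add: power2_eq_square algebra_simps)
  finally show "c\<^sup>2 *\<^sub>R 1 - x\<^sup>2 \<in> N" by (rule cancel_double_scale[OF assms(1)])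
next
  assume *: "c\<^sup>2 *\<^sub>R 1 - x\<^sup>2 \<in> N"
  have sq: "(c *\<^sub>R 1 - x)\<^sup>2 \<in> N" "(c *\<^sub>R 1 + x)\<^sup>2 \<in> N"
    using assms(2) by (auto intro!: square poly_values_add poly_values_diff const_in_poly_values)
  have "c *\<^sub>R (c *\<^sub>R 1 - x) + c *\<^sub>R (c *\<^sub>R 1 - x) \<in> N"
    by (rule sumI[OF sq(1) *]) (simp add: power2_eq_square algebra_simps)
  moreover have "c *\<^sub>R (c *\<^sub>R 1 + x) + c *\<^sub>R (c *\<^sub>R 1 + x) \<in> N"
    by (rule sumI[OF sq(2) *]) (simp add: power2_eq_square algebra_simps)
  ultimately show "bounded_by c x"
    unfolding bounded_by_def
    by - (rule conjI; rule cancel_double_scale[OF assms(1)], assumption)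
qed

lemma bounded_by_mult:
  assumes "0 < c" "0 < d" "x \<in> poly_values t b" "y \<in> poly_values t b"
    and "bounded_by c x" "bounded_by d y"
  shows "bounded_by (c * d) (x * y)"
proof -
  have "d\<^sup>2 *\<^sub>R (c\<^sup>2 *\<^sub>R 1 - x\<^sup>2) + x\<^sup>2 * (d\<^sup>2 *\<^sub>R 1 - y\<^sup>2) \<in> N"
    using assms by (intro add scale square_mult) (auto simp: bounded_by_iff_square)
  also have "d\<^sup>2 *\<^sub>R (c\<^sup>2 *\<^sub>R 1 - x\<^sup>2) + x\<^sup>2 * (d\<^sup>2 *\<^sub>R 1 - y\<^sup>2) = (c * d)\<^sup>2 *\<^sub>R 1 - (x * y)\<^sup>2"
    by (simp add: power2_eq_square algebra_simps)
  finally show ?thesis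
    using assms(1-4) bounded_by_iff_square[of "c * d" "x * y"] by (simp add: poly_values_mult)
qed

text \<open>
  The archimedean property: bounds on the generators propagate to the subalgebra.
\<close>

lemma bounded_poly_values:
  assumes "h \<in> poly_values t b"
  obtains c where "0 < c" "bounded_by c h"
proof -
  obtain \<phi> where "poly_expr t b h \<phi>" using assms unfolding poly_values_def by blast
  then have "\<exists>c>0. bounded_by c h"
  proof induction
    case (poly_const c)
    then show ?case using bounded_by_mono[OF bounded_by_const, of c "\<bar>c\<bar> + 1"]
      by (intro exI[of _ "\<bar>c\<bar> + 1"]) auto
  next
    case (poly_var i)
    define c where "c = \<bar>l i\<bar> + \<bar>u i\<bar> + 1"
    have *: "(c - u i) *\<^sub>R 1 \<in> N" "(c + l i) *\<^sub>R 1 \<in> N"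
      by (auto intro!: const simp: c_def)
    have "bounded_by c (b i)"
      unfolding bounded_by_def
      by (intro conjI sumI[OF *(1) upper[OF poly_var]] sumI[OF *(2) lower[OF poly_var]])
         (simp_all add: algebra_simps)
    moreover have "c > 0" by (auto simp: c_def)
    ultimately show ?case by blast
  next
    case (poly_add g \<gamma> h \<phi>)
    then obtain c d where "0 < c" "bounded_by c g" "0 < d" "bounded_by d h" by blast
    then have "0 < c + d \<and> bounded_by (c + d) (g + h)" by (simp add: bounded_by_add)
    then show ?case by blast
  next
    case (poly_mult g \<gamma> h \<phi>)
    then obtain c d where "0 < c" "bounded_by c g" "0 < d" "bounded_by d h" by blast
    moreover have "g \<in> poly_values t b" "h \<in> poly_values t b"
      using poly_mult.hyps unfolding poly_values_def by blast+
    ultimately have "0 < c * d \<and> bounded_by (c * d) (g * h)" by (simp add: bounded_by_mult)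
    then show ?case by blast
  qed
  then show thesis using that by blast
qed

definition adjoin :: "'a \<Rightarrow> 'a set" where
  "adjoin g = {m + \<sigma> * g | m \<sigma>. m \<in> N \<and> \<sigma> \<in> sums_of_squares (poly_values t b)}"

lemma subset_adjoin: "N \<subseteq> adjoin g"
proof
  fix m assume "m \<in> N"
  moreover have "m = m + 0 * g" by simp
  ultimately show "m \<in> adjoin g" unfolding adjoin_def using zero_in_sums_of_squares by blast
qed

lemma mem_adjoin: "g \<in> adjoin g"
proof -
  have "g = 0 + 1\<^sup>2 * g" by simp
  then show ?thesis
    unfolding adjoin_def
    using square_in_sums_of_squares[OF one_in_poly_values] const[of 0] by fastforce
qed

lemma box_module_adjoin: "box_module t b l u (adjoin g)"
proof
  fix m n assume "m \<in> adjoin g" "n \<in> adjoin g"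
  then obtain m' \<sigma> n' \<tau> where "m = m' + \<sigma> * g" "m' \<in> N" "\<sigma> \<in> sums_of_squares (poly_values t b)"
    "n = n' + \<tau> * g" "n' \<in> N" "\<tau> \<in> sums_of_squares (poly_values t b)"
    unfolding adjoin_def by blast
  then show "m + n \<in> adjoin g"
    unfolding adjoin_def using add sums_of_squares_add
    by (intro CollectI exI[of _ "m' + n'"] exI[of _ "\<sigma> + \<tau>"]) (auto simp: algebra_simps)
next
  fix a m assume a: "a \<in> poly_values t b" and "m \<in> adjoin g"
  then obtain m' \<sigma> where "m = m' + \<sigma> * g" "m' \<in> N" "\<sigma> \<in> sums_of_squares (poly_values t b)"
    unfolding adjoin_def by blast
  then have "a\<^sup>2 * m = a\<^sup>2 * m' + (a\<^sup>2 * \<sigma>) * g" "a\<^sup>2 * m' \<in> N"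
    "a\<^sup>2 * \<sigma> \<in> sums_of_squares (poly_values t b)"
    using square_mult[OF a] square_times_sums_of_squares poly_values_mult[OF a]
    by (auto simp: distrib_left mult.assoc)
  then show "a\<^sup>2 * m \<in> adjoin g" unfolding adjoin_def by blast
qed (use subset_adjoin one upper lower in blast)+

text \<open>
  This makes maximal proper modules total.  From \<open>-1 = m + \<sigma> g\<close> and \<open>-1 = n - \<tau> g\<close>, multiplying
  by \<open>\<tau>\<close> and \<open>\<sigma>\<close> and adding eliminates \<open>g\<close> and gives \<open>-(\<sigma> + \<tau>) \<in> N\<close>, hence \<open>-\<sigma> \<in> N\<close>.  As
  \<open>g\<close> is bounded below by \<open>-K\<close>, also \<open>\<sigma> g = \<sigma> (K + g) - K \<sigma>\<close> lies in \<open>N\<close>.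
\<close>

lemma minus_one_mem_if_both_adjoin:
  assumes "-1 \<in> adjoin g" "-1 \<in> adjoin (- g)" "0 \<le> K" "K *\<^sub>R 1 + g \<in> N"
  shows "-1 \<in> N"
proof -
  obtain m \<sigma> where m: "-1 = m + \<sigma> * g" "m \<in> N" "\<sigma> \<in> sums_of_squares (poly_values t b)"
    using assms(1) unfolding adjoin_def by blast
  obtain n \<tau> where n: "-1 = n + \<tau> * - g" "n \<in> N" "\<tau> \<in> sums_of_squares (poly_values t b)"
    using assms(2) unfolding adjoin_def by blast
  have "- \<sigma> = (\<tau> * m + \<sigma> * n) + \<tau> * 1"
  proof -
    have "m = -1 - \<sigma> * g" unfolding m(1) by simp
    moreover have "n = -1 + \<tau> * g" unfolding n(1) by simp
    ultimately have "\<tau> * m + \<sigma> * n = \<tau> * (-1 - \<sigma> * g) + \<sigma> * (-1 + \<tau> * g)" by simp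
    also have "\<dots> = - \<tau> - \<sigma>" by (simp add: algebra_simps)
    finally show ?thesis by simp
  qed
  then have "- \<sigma> \<in> N" using m n sos_mult add one by metis
  then have "K *\<^sub>R (- \<sigma>) + \<sigma> * (K *\<^sub>R 1 + g) \<in> N"
    by (rule add[OF scale[OF assms(3)] sos_mult[OF m(3) assms(4)]])
  then have "\<sigma> * g \<in> N" by (simp add: algebra_simps)
  then show ?thesis using m add by metis
qed

text \<open>
  Zorn's lemma, followed by the previous lemma.  Totality can be asserted only for elements \<open>g\<close>
  that are bounded below.
\<close>

lemma maximal_extension:
  assumes "-1 \<notin> N"
  obtains N' where "N \<subseteq> N'" "box_module t b l u N'" "-1 \<notin> N'"
    "\<forall>g K. K *\<^sub>R 1 + g \<in> N' \<longrightarrow> g \<in> N' \<or> - g \<in> N'"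
proof -
  define \<A> where "\<A> = {X. N \<subseteq> X \<and> box_module t b l u X \<and> -1 \<notin> X}"
  have "\<exists>X\<in>\<A>. \<forall>Y\<in>\<A>. X \<subseteq> Y \<longrightarrow> Y = X"
  proof (rule subset_Zorn_nonempty)
    show "\<A> \<noteq> {}" unfolding \<A>_def using assms box_module_axioms by blast
  next
    fix C assume C: "C \<noteq> {}" "subset.chain \<A> C"
    have mod: "box_module t b l u X" if "X \<in> C" for X
      using C that unfolding \<A>_def subset_chain_def by blast
    have "box_module t b l u (\<Union>C)"
    proof
      fix m n assume "m \<in> \<Union>C" "n \<in> \<Union>C"
      then obtain X where "X \<in> C" "m \<in> X" "n \<in> X"
        using C(2) unfolding subset_chain_def by blast
      then show "m + n \<in> \<Union>C" using box_module.add[OF mod] by blast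
    next
      fix a m assume "a \<in> poly_values t b" "m \<in> \<Union>C"
      then show "a\<^sup>2 * m \<in> \<Union>C" using box_module.square_mult[OF mod] by blast
    qed (use C mod box_module.one box_module.upper box_module.lower in blast)+
    then show "\<Union>C \<in> \<A>" using C unfolding \<A>_def subset_chain_def by blast
  qed
  then obtain X where X: "X \<in> \<A>" and max: "\<And>Y. Y \<in> \<A> \<Longrightarrow> X \<subseteq> Y \<Longrightarrow> Y = X" by blast
  interpret X: box_module t b l u X using X unfolding \<A>_def by blast
  have total: "g \<in> X \<or> - g \<in> X" if "K *\<^sub>R 1 + g \<in> X" for g K
  proof (rule ccontr)
    assume no: "\<not> (g \<in> X \<or> - g \<in> X)"
    have minus1: "-1 \<in> X.adjoin h" if "h \<notin> X" for h
    proof (rule ccontr)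
      assume "-1 \<notin> X.adjoin h"
      then have "X.adjoin h \<in> \<A>"
        using X X.subset_adjoin X.box_module_adjoin unfolding \<A>_def by blast
      then have "X.adjoin h = X" using max X.subset_adjoin by blast
      then show False using X.mem_adjoin that by blast
    qed
    have "max K 0 *\<^sub>R 1 + g \<in> X"
      by (rule X.sumI[OF X.const[of "max K 0 - K"] that]) (auto simp: algebra_simps)
    then have "-1 \<in> X"
      using X.minus_one_mem_if_both_adjoin[of g "max K 0"] minus1 no by simp
    then show False using X unfolding \<A>_def by blast
  qed
  show thesis
    using that[of X] X total unfolding \<A>_def by blast
qed


text \<open>
  A total proper module compares each \<open>b i\<close> with every real number and so cuts out a
  real value \<open>r i\<close>, as in a Dedekind cut.  Modulo infinitesimals every polynomial
  expression then equals its value at \<open>r\<close>; this replaces the character that the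
  Kadison-Dubois argument attaches to a maximal module.
\<close>

lemma evaluation_point:
  assumes "-1 \<notin> N" "\<forall>g K. K *\<^sub>R 1 + g \<in> N \<longrightarrow> g \<in> N \<or> - g \<in> N"
  obtains r where "r \<in> param_box t l u"
    "\<And>h \<phi> \<delta>. poly_expr t b h \<phi> \<Longrightarrow> 0 < \<delta> \<Longrightarrow> bounded_by \<delta> (h - \<phi> r *\<^sub>R 1)"
proof -
  have neg_const: "- c *\<^sub>R 1 \<notin> N" if "0 < c" for c
    using cancel_scale[OF that, of "-1"] assms(1) by auto
  define C where "C i = {c. b i - c *\<^sub>R 1 \<in> N}" for i
  define r where "r = (\<lambda>i\<in>{..<t}. Sup (C i))"
  have r: "r i = Sup (C i)" "l i \<in> C i" "\<And>c. c \<in> C i \<Longrightarrow> c \<le> u i" if "i < t" for i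
  proof -
    show "r i = Sup (C i)" "l i \<in> C i" using that lower unfolding r_def C_def by simp_all
    show "c \<le> u i" if "c \<in> C i" for c
    proof (rule ccontr)
      assume "\<not> c \<le> u i"
      moreover have "- (c - u i) *\<^sub>R 1 \<in> N"
        by (rule sumI[OF upper[OF \<open>i < t\<close>], of "b i - c *\<^sub>R 1"])
           (use that in \<open>auto simp: C_def algebra_simps\<close>)
      ultimately show False using neg_const[of "c - u i"] by simp
    qed
  qed
  have bdd: "bdd_above (C i)" "C i \<noteq> {}" if "i < t" for i
    using r[OF that] unfolding bdd_above_def by blast+
  have near: "bounded_by \<delta> (b i - r i *\<^sub>R 1)" if i: "i < t" and "0 < \<delta>" for i \<delta>
  proof -
    obtain c where c: "c \<in> C i" "r i - \<delta> < c"
      using less_cSup_iff[OF bdd(2,1)[OF i], of "r i - \<delta>"] r(1)[OF i] \<open>0 < \<delta>\<close> by auto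
    have 1: "\<delta> *\<^sub>R 1 + (b i - r i *\<^sub>R 1) \<in> N"
      by (rule sumI[of "(c - (r i - \<delta>)) *\<^sub>R 1" "b i - c *\<^sub>R 1"])
         (use c const[of "c - (r i - \<delta>)"] in \<open>auto simp: C_def algebra_simps\<close>)
    have "r i + \<delta> \<notin> C i"
      using cSup_upper[OF _ bdd(1)[OF i], of "r i + \<delta>"] r(1)[OF i] \<open>0 < \<delta>\<close> by auto
    then have not: "b i - (r i + \<delta>) *\<^sub>R 1 \<notin> N" unfolding C_def by simp
    have "(\<bar>l i\<bar> + \<bar>r i + \<delta>\<bar>) *\<^sub>R 1 + (b i - (r i + \<delta>) *\<^sub>R 1) \<in> N"
      by (rule sumI[OF lower[OF i] const[of "(\<bar>l i\<bar> + l i) + (\<bar>r i + \<delta>\<bar> - (r i + \<delta>))"]])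
         (auto simp: algebra_simps)
    then have "- (b i - (r i + \<delta>) *\<^sub>R 1) \<in> N" using assms(2) not by blast
    then have 2: "\<delta> *\<^sub>R 1 - (b i - r i *\<^sub>R 1) \<in> N" by (simp add: algebra_simps)
    show ?thesis unfolding bounded_by_def using 1 2 by blast
  qed
  have "r \<in> param_box t l u"
    unfolding param_box_def
  proof (rule PiE_I)
    fix i assume "i \<in> {..<t}"
    then have i: "i < t" by simp
    show "r i \<in> {l i..u i}"
      using cSup_upper[OF r(2)[OF i] bdd(1)[OF i]] cSup_least[OF bdd(2)[OF i] r(3)[OF i]] r(1)[OF i]
      by simp
  qed (simp add: r_def)
  moreover have "bounded_by \<delta> (h - \<phi> r *\<^sub>R 1)" if "poly_expr t b h \<phi>" "0 < \<delta>" for h \<phi> \<delta>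
    using that
  proof (induction arbitrary: \<delta>)
    case (poly_const c)
    then show ?case using const[of \<delta>] unfolding bounded_by_def by simp
  next
    case (poly_var i)
    then show ?case by (rule near)
  next
    case (poly_add g \<gamma> h \<phi>)
    have "bounded_by (\<delta> / 2 + \<delta> / 2) ((g - \<gamma> r *\<^sub>R 1) + (h - \<phi> r *\<^sub>R 1))"
      using poly_add by (intro bounded_by_add) auto
    then show ?case by (simp add: algebra_simps)
  next
    case (poly_mult g \<gamma> h \<phi>)
    have vals: "g \<in> poly_values t b" "h \<in> poly_values t b"
      using poly_mult.hyps unfolding poly_values_def by blast+
    obtain c where c: "0 < c" "bounded_by c g" using bounded_poly_values[OF vals(1)] .
    define d where "d = \<bar>\<phi> r\<bar> + 1"
    have d: "0 < d" "bounded_by d (\<phi> r *\<^sub>R 1)"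
      using bounded_by_mono[OF bounded_by_const, of "\<phi> r" d] unfolding d_def by auto
    have "bounded_by (c * (\<delta> / (2 * c)) + (\<delta> / (2 * d)) * d)
      (g * (h - \<phi> r *\<^sub>R 1) + (g - \<gamma> r *\<^sub>R 1) * (\<phi> r *\<^sub>R 1))"
      using poly_mult c d vals
      by (intro bounded_by_add bounded_by_mult poly_values_diff const_in_poly_values) auto
    moreover have "c * (\<delta> / (2 * c)) + (\<delta> / (2 * d)) * d = \<delta>" using c d by (simp add: field_simps)
    moreover have "g * (h - \<phi> r *\<^sub>R 1) + (g - \<gamma> r *\<^sub>R 1) * (\<phi> r *\<^sub>R 1) = g * h - (\<gamma> r * \<phi> r) *\<^sub>R 1"
      by (simp add: algebra_simps)
    ultimately show ?case by simp
  qed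
  ultimately show thesis using that by blast
qed

section \<open>A Positivstellensatz on the box\<close>

text \<open>
  If \<open>-1\<close> were not in \<open>N - \<sigma> h\<close> for any \<open>\<sigma>\<close>, a maximal proper module containing \<open>- h\<close> would
  have an evaluation point \<open>r\<close> in the box, where \<open>h\<close> is close to \<open>\<phi> r > 0\<close>.
\<close>

lemma sos_multiple_above_one:
  assumes "poly_expr t b h \<phi>" "\<And>r. r \<in> param_box t l u \<Longrightarrow> 0 < \<phi> r"
  obtains \<sigma> where "\<sigma> \<in> sums_of_squares (poly_values t b)" "\<sigma> * h - 1 \<in> N"
proof -
  have "-1 \<in> adjoin (- h)"
  proof (rule ccontr)
    assume no: "-1 \<notin> adjoin (- h)"
    interpret A: box_module t b l u "adjoin (- h)" by (rule box_module_adjoin)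
    obtain X where X: "adjoin (- h) \<subseteq> X" "box_module t b l u X" "-1 \<notin> X"
      "\<forall>g K. K *\<^sub>R 1 + g \<in> X \<longrightarrow> g \<in> X \<or> - g \<in> X"
      using A.maximal_extension[OF no] by blast
    interpret X: box_module t b l u X by (rule X(2))
    obtain r where r: "r \<in> param_box t l u"
      "\<And>h \<phi> \<delta>. poly_expr t b h \<phi> \<Longrightarrow> 0 < \<delta> \<Longrightarrow> X.bounded_by \<delta> (h - \<phi> r *\<^sub>R 1)"
      by (rule X.evaluation_point[OF X(3,4)]) blast
    have pos: "0 < \<phi> r / 2" using assms(2) r(1) by simp
    have "(\<phi> r / 2) *\<^sub>R (-1) \<in> X"
    proof (rule X.sumI)
      show "(\<phi> r / 2) *\<^sub>R 1 + (h - \<phi> r *\<^sub>R 1) \<in> X"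
        using r(2)[OF assms(1) pos] unfolding X.bounded_by_def by blast
      show "- h \<in> X" using X(1) mem_adjoin by blast
      have "(\<phi> r / 2) *\<^sub>R (1::'a) + (\<phi> r / 2) *\<^sub>R 1 = \<phi> r *\<^sub>R 1"
        unfolding scaleR_left_distrib[symmetric] by simp
      then show "(\<phi> r / 2) *\<^sub>R (-1) = (\<phi> r / 2) *\<^sub>R 1 + (h - \<phi> r *\<^sub>R 1) + - h"
        by (simp add: algebra_simps)
    qed
    then show False using X.cancel_scale[OF pos] X(3) by blast
  qed
  then obtain m \<sigma> where "-1 = m + \<sigma> * - h" "m \<in> N" "\<sigma> \<in> sums_of_squares (poly_values t b)"
    unfolding adjoin_def by blast
  moreover from this(1) have "\<sigma> * h - 1 = m" by (simp add: algebra_simps)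
  ultimately show thesis using that by blast
qed

text \<open>
  Putinar's theorem for the box.  Starting from \<open>h + \<rho> \<in> N\<close> for some large \<open>\<rho>\<close>,
  the constant can be lowered repeatedly by a fixed amount \<open>1/k\<close>, owing to the identity
  \<open>k\<^sup>2 (h + \<rho> - 1/k) = (k - \<sigma>)\<^sup>2 (h + \<rho>) + 2 k (\<sigma> h - 1) + \<rho> \<sigma> (2 k - \<sigma>) + (k - \<sigma>\<^sup>2 h)\<close>,
  whose summands lie in \<open>N\<close> once \<open>k\<close> bounds \<open>\<sigma>\<close> and \<open>\<sigma>\<^sup>2 h\<close>.
\<close>

lemma positive_on_box_mem:
  assumes "poly_expr t b h \<phi>" "\<And>r. r \<in> param_box t l u \<Longrightarrow> 0 < \<phi> r"
  shows "h \<in> N"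
proof -
  obtain \<sigma> where \<sigma>: "\<sigma> \<in> sums_of_squares (poly_values t b)" "\<sigma> * h - 1 \<in> N"
    using sos_multiple_above_one[OF assms] by blast
  have vals: "h \<in> poly_values t b" "\<sigma> \<in> poly_values t b"
    using assms(1) sums_of_squares_subset_poly_values[OF \<sigma>(1)] unfolding poly_values_def by blast+
  obtain C where C: "0 < C" "bounded_by C h" using bounded_poly_values[OF vals(1)] .
  obtain k\<^sub>1 where k\<^sub>1: "0 < k\<^sub>1" "bounded_by k\<^sub>1 \<sigma>" using bounded_poly_values[OF vals(2)] .
  obtain k\<^sub>2 where k\<^sub>2: "0 < k\<^sub>2" "bounded_by k\<^sub>2 (\<sigma>\<^sup>2 * h)"
    using bounded_poly_values[of "\<sigma>\<^sup>2 * h"] vals poly_values_mult poly_values_square by metis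
  define k where "k = max k\<^sub>1 k\<^sub>2"
  have k: "0 < k" "bounded_by k (\<sigma>\<^sup>2 * h)" "bounded_by (k + k) \<sigma>"
    using bounded_by_mono[OF k\<^sub>1(2), of "k + k"] bounded_by_mono[OF k\<^sub>2(2), of k] k\<^sub>1(1) k\<^sub>2(1)
    unfolding k_def by auto
  have step: "h + (\<rho> - 1 / k) *\<^sub>R 1 \<in> N" if \<rho>: "0 \<le> \<rho>" "h + \<rho> *\<^sub>R 1 \<in> N" for \<rho>
  proof -
    have "(k *\<^sub>R 1 - \<sigma>)\<^sup>2 * (h + \<rho> *\<^sub>R 1) + (k *\<^sub>R (\<sigma> * h - 1) + k *\<^sub>R (\<sigma> * h - 1))
        + \<rho> *\<^sub>R (\<sigma> * (k *\<^sub>R 1 + k *\<^sub>R 1 - \<sigma>)) + (k *\<^sub>R 1 - \<sigma>\<^sup>2 * h) \<in> N"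
    proof (intro add)
      show "(k *\<^sub>R 1 - \<sigma>)\<^sup>2 * (h + \<rho> *\<^sub>R 1) \<in> N"
        by (intro square_mult poly_values_diff const_in_poly_values vals \<rho>)
      show "k *\<^sub>R (\<sigma> * h - 1) \<in> N" "k *\<^sub>R (\<sigma> * h - 1) \<in> N"
        using scale[OF _ \<sigma>(2), of k] k(1) by auto
      show "\<rho> *\<^sub>R (\<sigma> * (k *\<^sub>R 1 + k *\<^sub>R 1 - \<sigma>)) \<in> N" "k *\<^sub>R 1 - \<sigma>\<^sup>2 * h \<in> N"
        using scale[OF \<rho>(1) sos_mult[OF \<sigma>(1)]] k(2,3)
        unfolding bounded_by_def scaleR_left_distrib by blast+
    qed
    also have "(k *\<^sub>R 1 - \<sigma>)\<^sup>2 * (h + \<rho> *\<^sub>R 1) + (k *\<^sub>R (\<sigma> * h - 1) + k *\<^sub>R (\<sigma> * h - 1))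
        + \<rho> *\<^sub>R (\<sigma> * (k *\<^sub>R 1 + k *\<^sub>R 1 - \<sigma>)) + (k *\<^sub>R 1 - \<sigma>\<^sup>2 * h)
        = k\<^sup>2 *\<^sub>R h + k\<^sup>2 *\<^sub>R \<rho> *\<^sub>R 1 - k *\<^sub>R 1"
      by (simp add: power2_eq_square algebra_simps)
    also have "\<dots> = k\<^sup>2 *\<^sub>R (h + (\<rho> - 1 / k) *\<^sub>R 1)"
      using k(1) by (simp add: power2_eq_square algebra_simps)
    finally show ?thesis using cancel_scale[of "k\<^sup>2"] k(1) by simp
  qed
  have descent: "h + max 0 (C - real n / k) *\<^sub>R 1 \<in> N" for n
  proof (induction n)
    case 0
    then show ?case using C unfolding bounded_by_def by (simp add: algebra_simps)
  next
    case (Suc n)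
    let ?\<rho> = "max 0 (C - real n / k)" and ?\<rho>' = "max 0 (C - real (Suc n) / k)"
    have "real (Suc n) / k = real n / k + 1 / k" "0 < 1 / k"
      using k(1) by (simp_all add: add_divide_distrib)
    then have "0 \<le> ?\<rho>' - (?\<rho> - 1 / k)" by linarith
    then show ?case
      by (intro sumI[OF step[OF _ Suc] const[of "?\<rho>' - (?\<rho> - 1 / k)"]]) (auto simp: algebra_simps)
  qed
  obtain n where "C * k \<le> real n" using real_arch_simple by blast
  then have "max 0 (C - real n / k) = 0" using k(1) by (simp add: field_simps)
  then show ?thesis using descent[of n] by simp
qed

end

section \<open>Polynomial partitions into squares\<close>

lemma compact_param_box: "compact (param_box t l u)"
proof -
  let ?S = "\<lambda>i. if i < t then {l i..u i} else {undefined}"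
  have "compactin (product_topology (\<lambda>i. euclidean) UNIV) (PiE UNIV ?S)"
    unfolding compactin_PiE by auto
  moreover have "param_box t l u = PiE UNIV ?S"
    unfolding param_box_def PiE_def Pi_def extensional_def by (auto split: if_splits)
  ultimately show ?thesis by (simp add: euclidean_product_topology)
qed

text \<open>
  Up to \<open>\<epsilon>\<close>, a partition of unity by squares of functions in \<open>R\<close> whose member with index \<open>r\<close> is
  concentrated where \<open>\<mu> r\<close> is small.  The exact continuous partition is
  \<open>e r = sqrt (\<psi> r / \<Psi>)\<close> with \<open>\<psi> r = max 0 (\<epsilon>/2 - \<mu> r)\<close>; the cut-off makes every product
  \<open>(e r)\<^sup>2 * \<mu> r\<close> at most \<open>\<epsilon>/2 * (e r)\<^sup>2\<close>, compactness makes finitely many \<open>r\<close> suffice, and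
  Stone-Weierstrass replaces \<open>e r\<close> by an element of \<open>R\<close>.
\<close>

lemma (in function_ring_on) approximate_partition_into_squares:
  fixes \<mu> :: "'a \<Rightarrow> 'a \<Rightarrow> real"
  assumes cont: "\<And>r. r \<in> S \<Longrightarrow> continuous_on S (\<mu> r)"
    and nonneg: "\<And>r x. r \<in> S \<Longrightarrow> x \<in> S \<Longrightarrow> 0 \<le> \<mu> r x"
    and zero: "\<And>r. r \<in> S \<Longrightarrow> \<mu> r r = 0"
    and "0 < \<epsilon>"
  obtains T E where "finite T" "T \<subseteq> S" "\<forall>r\<in>T. E r \<in> R"
    "\<forall>x\<in>S. \<bar>1 - (\<Sum>r\<in>T. (E r x)\<^sup>2)\<bar> < \<epsilon>"
    "\<forall>x\<in>S. (\<Sum>r\<in>T. (E r x)\<^sup>2 * \<mu> r x) < \<epsilon>"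
proof -
  have "\<exists>U. open U \<and> U \<inter> S = \<mu> r -` {..<\<epsilon>/2} \<inter> S" if "r \<in> S" for r
    using cont[OF that] open_lessThan[of "\<epsilon>/2"] unfolding continuous_on_open_invariant by blast
  then obtain U where U: "\<And>r. r \<in> S \<Longrightarrow> open (U r)"
    "\<And>r. r \<in> S \<Longrightarrow> U r \<inter> S = \<mu> r -` {..<\<epsilon>/2} \<inter> S" by metis
  have cover: "S \<subseteq> (\<Union>r\<in>S. U r)"
  proof
    fix r assume "r \<in> S"
    then have "r \<in> U r" using U(2)[of r] zero[of r] \<open>0 < \<epsilon>\<close> by auto
    then show "r \<in> (\<Union>r\<in>S. U r)" using \<open>r \<in> S\<close> by blast
  qed
  obtain T where T: "T \<subseteq> S" "finite T" "S \<subseteq> (\<Union>r\<in>T. U r)"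
    using compactE_image[OF compact U(1) cover] by blast
  define \<psi> where "\<psi> r x = max 0 (\<epsilon>/2 - \<mu> r x)" for r x
  define \<Psi> where "\<Psi> x = (\<Sum>r\<in>T. \<psi> r x)" for x
  have \<psi>_nonneg: "0 \<le> \<psi> r x" for r x unfolding \<psi>_def by simp
  have \<Psi>_pos: "0 < \<Psi> x" if x: "x \<in> S" for x
  proof -
    obtain r where "r \<in> T" "x \<in> U r" using T(3) x by blast
    then have "\<mu> r x < \<epsilon>/2" using U(2)[of r] T(1) x by blast
    then show ?thesis
      unfolding \<Psi>_def using \<open>r \<in> T\<close> T(2) \<psi>_nonneg by (intro sum_pos2[of _ r]) (auto simp: \<psi>_def)
  qed
  define e where "e r x = sqrt (\<psi> r x / \<Psi> x)" for r x
  have cont_\<psi>: "continuous_on S (\<psi> r)" if "r \<in> T" for r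
    unfolding \<psi>_def using cont T(1) that by (intro continuous_intros) auto
  then have cont_\<Psi>: "continuous_on S \<Psi>"
    unfolding \<Psi>_def by (intro continuous_on_sum)
  have cont_e: "continuous_on S (e r)" if "r \<in> T" for r
    unfolding e_def using cont_\<psi>[OF that] cont_\<Psi> \<Psi>_pos
    by (intro continuous_on_real_sqrt continuous_on_divide) (auto simp: less_imp_neq[symmetric])
  have e_sq: "(e r x)\<^sup>2 = \<psi> r x / \<Psi> x" if "x \<in> S" for r x
    unfolding e_def using \<psi>_nonneg[of r x] \<Psi>_pos[OF that] by simp
  have e_sum: "(\<Sum>r\<in>T. (e r x)\<^sup>2) = 1" if "x \<in> S" for x
    using \<Psi>_pos[OF that] unfolding e_sq[OF that] sum_divide_distrib[symmetric] \<Psi>_def by simp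
  have e_bound: "0 \<le> e r x" "e r x \<le> 1" if "x \<in> S" "r \<in> T" for r x
  proof -
    show "0 \<le> e r x" unfolding e_def using \<psi>_nonneg[of r x] \<Psi>_pos[OF that(1)] by simp
    have "(e r x)\<^sup>2 \<le> (\<Sum>r\<in>T. (e r x)\<^sup>2)" using T(2) that by (intro member_le_sum) auto
    then have "(e r x)\<^sup>2 \<le> 1" using e_sum[OF that(1)] by simp
    then show "e r x \<le> 1" by (simp add: abs_square_le_1 abs_le_iff)
  qed
  have e_local: "(\<Sum>r\<in>T. (e r x)\<^sup>2 * \<mu> r x) \<le> \<epsilon>/2" if x: "x \<in> S" for x
  proof -
    have "(e r x)\<^sup>2 * \<mu> r x \<le> (e r x)\<^sup>2 * (\<epsilon>/2)" for r
    proof (cases "\<mu> r x \<le> \<epsilon>/2")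
      case True
      then show ?thesis by (rule mult_left_mono) simp
    next
      case False
      then show ?thesis unfolding e_sq[OF x] \<psi>_def by simp
    qed
    then have "(\<Sum>r\<in>T. (e r x)\<^sup>2 * \<mu> r x) \<le> (\<Sum>r\<in>T. (e r x)\<^sup>2 * (\<epsilon>/2))" by (rule sum_mono)
    then show ?thesis unfolding sum_distrib_right[symmetric] e_sum[OF x] by simp
  qed
  obtain K where K: "0 \<le> K" "\<And>r x. r \<in> T \<Longrightarrow> x \<in> S \<Longrightarrow> \<mu> r x \<le> K"
  proof -
    have "\<exists>k. \<forall>x\<in>S. \<mu> r x \<le> k" if "r \<in> T" for r
      using compact_continuous_image[OF cont compact] T(1) that compact_imp_bounded bounded_imp_bdd_above
      unfolding bdd_above_def by (metis image_eqI subsetD)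
    then obtain k where k: "\<And>r x. r \<in> T \<Longrightarrow> x \<in> S \<Longrightarrow> \<mu> r x \<le> k r" by metis
    show thesis
    proof (rule that[of "\<Sum>r\<in>T. \<bar>k r\<bar>"])
      show "\<mu> r x \<le> (\<Sum>r\<in>T. \<bar>k r\<bar>)" if "r \<in> T" "x \<in> S" for r x
        using k[OF that] member_le_sum[of r T "\<lambda>r. \<bar>k r\<bar>"] that T(2) by fastforce
    qed (simp add: sum_nonneg)
  qed
  \<comment> \<open>Tolerance for each square: summed over \<open>T\<close>, also with weights \<open>\<mu> r \<le> K\<close>, the errors stay below \<open>\<epsilon>/2\<close>.\<close>
  define \<eta> where "\<eta> = \<epsilon> / (2 * (real (card T) + 1) * (K + 1))"
  have \<eta>: "0 < \<eta>" unfolding \<eta>_def using \<open>0 < \<epsilon>\<close> K(1) by (intro divide_pos_pos mult_pos_pos) auto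
  have card_\<eta>: "card T * \<eta> * (K + 1) < \<epsilon>/2"
  proof -
    have "card T * \<eta> * (K + 1) = \<epsilon>/2 * (card T / (card T + 1))"
      unfolding \<eta>_def using K(1) by (simp add: divide_simps)
    also have "\<dots> < \<epsilon>/2 * 1" using \<open>0 < \<epsilon>\<close> by (intro mult_strict_left_mono) auto
    finally show ?thesis by simp
  qed
  have "card T * \<eta> * K \<le> card T * \<eta> * (K + 1)" "card T * \<eta> \<le> card T * \<eta> * (K + 1)"
    using \<eta> K(1) by (simp_all add: distrib_left)
  then have small: "card T * \<eta> < \<epsilon>/2" "card T * \<eta> * K < \<epsilon>/2" using card_\<eta> by linarith+
  \<comment> \<open>For \<open>0 \<le> e \<le> 1\<close> and \<open>\<bar>E - e\<bar> < \<delta> \<le> 1\<close> the factor \<open>\<bar>E + e\<bar>\<close> of \<open>\<bar>E\<^sup>2 - e\<^sup>2\<bar>\<close> is at most 3.\<close>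
  define \<delta> where "\<delta> = min 1 (\<eta> / 3)"
  have "0 < \<delta>" unfolding \<delta>_def using \<eta> by simp
  then have "\<exists>g\<in>R. \<forall>x\<in>S. \<bar>e r x - g x\<bar> < \<delta>" if "r \<in> T" for r
    using Stone_Weierstrass_basic[OF cont_e[OF that]] by blast
  then obtain E where E: "\<And>r. r \<in> T \<Longrightarrow> E r \<in> R"
    "\<And>r x. r \<in> T \<Longrightarrow> x \<in> S \<Longrightarrow> \<bar>e r x - E r x\<bar> < \<delta>" by metis
  have close: "\<bar>(E r x)\<^sup>2 - (e r x)\<^sup>2\<bar> \<le> \<eta>" if "r \<in> T" "x \<in> S" for r x
  proof -
    have "\<bar>(E r x)\<^sup>2 - (e r x)\<^sup>2\<bar> = \<bar>E r x - e r x\<bar> * \<bar>E r x + e r x\<bar>"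
      unfolding abs_mult[symmetric] by (simp add: power2_eq_square algebra_simps)
    also have "\<dots> \<le> \<delta> * 3"
    proof (rule mult_mono)
      have "\<bar>E r x - e r x\<bar> < \<delta>" using E(2)[OF that] by (simp add: abs_minus_commute)
      then show "\<bar>E r x - e r x\<bar> \<le> \<delta>" by simp
      have "\<delta> \<le> 1" unfolding \<delta>_def by simp
      then show "\<bar>E r x + e r x\<bar> \<le> 3"
        using \<open>\<bar>E r x - e r x\<bar> < \<delta>\<close> e_bound[OF that(2,1)] by linarith
    qed (use \<open>0 < \<delta>\<close> in auto)
    also have "\<dots> \<le> \<eta>" unfolding \<delta>_def by simp
    finally show ?thesis .
  qed
  show thesis
  proof (rule that[OF T(2,1)]; intro ballI)
    fix r assume "r \<in> T"
    then show "E r \<in> R" by (rule E(1))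
  next
    fix x assume x: "x \<in> S"
    have "\<bar>1 - (\<Sum>r\<in>T. (E r x)\<^sup>2)\<bar> = \<bar>\<Sum>r\<in>T. (E r x)\<^sup>2 - (e r x)\<^sup>2\<bar>"
      unfolding sum_subtractf e_sum[OF x] by simp
    also have "\<dots> \<le> (\<Sum>r\<in>T. \<eta>)" using close x by (intro order_trans[OF sum_abs] sum_mono) blast
    finally show "\<bar>1 - (\<Sum>r\<in>T. (E r x)\<^sup>2)\<bar> < \<epsilon>" using small \<open>0 < \<epsilon>\<close> by simp
  next
    fix x assume x: "x \<in> S"
    have "(\<Sum>r\<in>T. (E r x)\<^sup>2 * \<mu> r x) \<le> (\<Sum>r\<in>T. (e r x)\<^sup>2 * \<mu> r x + \<eta> * K)"
    proof (rule sum_mono)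
      fix r assume r: "r \<in> T"
      have "((E r x)\<^sup>2 - (e r x)\<^sup>2) * \<mu> r x \<le> \<eta> * K"
        using close[OF r x] K(2)[OF r x] nonneg[of r x] r x T(1) \<eta>
        by (intro mult_mono) auto
      then show "(E r x)\<^sup>2 * \<mu> r x \<le> (e r x)\<^sup>2 * \<mu> r x + \<eta> * K" by (simp add: algebra_simps)
    qed
    also have "\<dots> = (\<Sum>r\<in>T. (e r x)\<^sup>2 * \<mu> r x) + card T * \<eta> * K" by (simp add: sum.distrib)
    finally show "(\<Sum>r\<in>T. (E r x)\<^sup>2 * \<mu> r x) < \<epsilon>" using e_local[OF x] small(2) by linarith
  qed
qed

lemma function_ring_on_poly_functions:
  "function_ring_on {\<phi>. \<exists>h. poly_expr t b h \<phi>} (param_box t l u)"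
proof
  show "compact (param_box t l u)" by (rule compact_param_box)
next
  fix x y assume xy: "x \<in> param_box t l u" "y \<in> param_box t l u" "x \<noteq> y"
  have "\<exists>i<t. x i \<noteq> y i"
  proof (rule ccontr)
    assume "\<not> (\<exists>i<t. x i \<noteq> y i)"
    then have "x = y" by (intro PiE_ext[OF xy(1,2)[unfolded param_box_def]]) simp
    then show False using xy(3) by blast
  qed
  then obtain i where i: "i < t" "x i \<noteq> y i" by blast
  then show "\<exists>f\<in>{\<phi>. \<exists>h. poly_expr t b h \<phi>}. f x \<noteq> f y" 
    using poly_var[OF i(1), of b] i(2) by (intro bexI[of _ "\<lambda>x. x i"] CollectI exI) auto
next
  fix \<gamma> \<phi> assume "\<gamma> \<in> {\<phi>. \<exists>h. poly_expr t b h \<phi>}" "\<phi> \<in> {\<phi>. \<exists>h. poly_expr t b h \<phi>}"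
  then obtain g h where *: "poly_expr t b g \<gamma>" "poly_expr t b h \<phi>" by blast
  show "(\<lambda>x. \<gamma> x + \<phi> x) \<in> {\<phi>. \<exists>h. poly_expr t b h \<phi>}" by (intro CollectI exI) (rule poly_add[OF *])
  show "(\<lambda>x. \<gamma> x * \<phi> x) \<in> {\<phi>. \<exists>h. poly_expr t b h \<phi>}" by (intro CollectI exI) (rule poly_mult[OF *])
next
  fix c show "(\<lambda>_. c) \<in> {\<phi>. \<exists>h. poly_expr t b h \<phi>}" by (intro CollectI exI) (rule poly_const)
qed (blast intro: continuous_on_poly_expr)

section \<open>Gluing memberships on the fibres\<close>

context box_module
begin

lemma bounded_by_of_box_bound:
  assumes "poly_expr t b h \<phi>" "\<And>x. x \<in> param_box t l u \<Longrightarrow> \<bar>\<phi> x\<bar> < \<epsilon>"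
  shows "bounded_by \<epsilon> h"
  unfolding bounded_by_def
proof
  show "\<epsilon> *\<^sub>R 1 - h \<in> N"
    using assms(2) by (intro positive_on_box_mem[OF poly_expr_diff[OF poly_const assms(1)]]) fastforce
  show "\<epsilon> *\<^sub>R 1 + h \<in> N"
    using assms(2) by (intro positive_on_box_mem[OF poly_add[OF poly_const assms(1)]]) fastforce
qed

lemma sumI_finite: "(\<And>x. x \<in> X \<Longrightarrow> m x \<in> N) \<Longrightarrow> (\<Sum>x\<in>X. m x) \<in> N"
  using const[of 0] by (induction X rule: infinite_finite_induct) (auto intro: add)

text \<open>
  Although \<open>a\<close> need not be bounded, it is a difference of two squares, and a small coefficient \<open>h\<close>
  on a square \<open>c\<^sup>2\<close> is compensated by \<open>\<epsilon> c\<^sup>2\<close>.  The compensating element depends on \<open>a\<close> but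
  not on \<open>h\<close>.
\<close>

lemma absorb_small_multiple:
  assumes full: "\<And>a m. m \<in> N \<Longrightarrow> a\<^sup>2 * m \<in> N"
    and "0 < \<epsilon>" "bounded_by \<epsilon> h"
  shows "h * a + \<epsilon> *\<^sub>R (a\<^sup>2 + 1) \<in> N"
proof -
  have "a\<^sup>2 + 1 \<in> N" using add[OF full[OF one, of a] one] by simp
  then have *: "\<epsilon> *\<^sub>R (a\<^sup>2 + 1) \<in> N" using scale \<open>0 < \<epsilon>\<close> by simp
  have "((a + 1)\<^sup>2 * (\<epsilon> *\<^sub>R 1 + h) + (a - 1)\<^sup>2 * (\<epsilon> *\<^sub>R 1 - h))
      + (\<epsilon> *\<^sub>R (a\<^sup>2 + 1) + \<epsilon> *\<^sub>R (a\<^sup>2 + 1)) \<in> N" (is "?x \<in> N")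
    using assms(3) unfolding bounded_by_def by (auto intro: add[OF add[OF full full] add[OF * *]])
  also have "?x = 2 *\<^sub>R (h * a + \<epsilon> *\<^sub>R (a\<^sup>2 + 1)) + 2 *\<^sub>R (h * a + \<epsilon> *\<^sub>R (a\<^sup>2 + 1))"
    unfolding scaleR_2 by (simp add: power2_eq_square algebra_simps)
  finally have "2 *\<^sub>R (h * a + \<epsilon> *\<^sub>R (a\<^sup>2 + 1)) + 2 *\<^sub>R (h * a + \<epsilon> *\<^sub>R (a\<^sup>2 + 1)) \<in> N" .
  then show ?thesis by (rule cancel_double_scale[of 2, rotated]) simp
qed

text \<open>
  Weight the representations \<open>f = s r + (\<Sum>a\<in>G. g r a * a)\<close> on the fibres with an approximate
  partition into squares \<open>(e r)\<^sup>2\<close> adapted to \<open>\<mu> r = (\<Sum>a\<in>G. \<bar>\<gamma> r a\<bar>)\<close>, which vanishes at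
  \<open>r\<close>.  The total coefficient of each generator \<open>a\<close> becomes uniformly small on the box, and so does
  the defect \<open>1 - (\<Sum>r\<in>T. (e r)\<^sup>2)\<close>, which multiplies \<open>f\<close>.  Both are absorbed, so \<open>f\<close> has to be
  treated like a further generator.
\<close>

lemma glue_fibres:
  assumes full: "\<And>a m. m \<in> N \<Longrightarrow> a\<^sup>2 * m \<in> N"
    and "finite G"
    and fibre: "\<And>r. r \<in> param_box t l u \<Longrightarrow> \<exists>s\<in>N. \<exists>g \<gamma>.
      (\<forall>a\<in>G. poly_expr t b (g a) (\<gamma> a) \<and> \<gamma> a r = 0) \<and> f = s + (\<Sum>a\<in>G. g a * a)"
    and "0 < \<epsilon>"
  shows "f + \<epsilon> *\<^sub>R ((f\<^sup>2 + 1) + (\<Sum>a\<in>G. a\<^sup>2 + 1)) \<in> N"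
proof -
  let ?B = "param_box t l u"
  obtain s g \<gamma> where s: "\<And>r. r \<in> ?B \<Longrightarrow> s r \<in> N"
    and g: "\<And>r a. r \<in> ?B \<Longrightarrow> a \<in> G \<Longrightarrow> poly_expr t b (g r a) (\<gamma> r a)"
    and \<gamma>: "\<And>r a. r \<in> ?B \<Longrightarrow> a \<in> G \<Longrightarrow> \<gamma> r a r = 0"
    and f: "\<And>r. r \<in> ?B \<Longrightarrow> f = s r + (\<Sum>a\<in>G. g r a * a)"
  proof -
    have "\<forall>r\<in>?B. \<exists>s g \<gamma>. s \<in> N \<and> (\<forall>a\<in>G. poly_expr t b (g a) (\<gamma> a) \<and> \<gamma> a r = 0)
        \<and> f = s + (\<Sum>a\<in>G. g a * a)"
      using fibre by blast
    then show thesis using that by (simp only: bchoice_iff) blast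
  qed
  interpret P: function_ring_on "{\<phi>. \<exists>h. poly_expr t b h \<phi>}" ?B
    by (rule function_ring_on_poly_functions)
  define \<mu> where "\<mu> r x = (\<Sum>a\<in>G. \<bar>\<gamma> r a x\<bar>)" for r x
  have \<mu>: "continuous_on ?B (\<mu> r)" "0 \<le> \<mu> r x" "\<mu> r r = 0" if "r \<in> ?B" for r x
    unfolding \<mu>_def using \<gamma>[OF that]
    by (auto intro!: continuous_on_sum continuous_on_rabs continuous_on_poly_expr[OF g[OF that]]
        sum_nonneg)
  obtain T E where T: "finite T" "T \<subseteq> ?B" "\<forall>r\<in>T. E r \<in> {\<phi>. \<exists>h. poly_expr t b h \<phi>}"
    "\<forall>x\<in>?B. \<bar>1 - (\<Sum>r\<in>T. (E r x)\<^sup>2)\<bar> < \<epsilon>"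
    "\<forall>x\<in>?B. (\<Sum>r\<in>T. (E r x)\<^sup>2 * \<mu> r x) < \<epsilon>"
    using P.approximate_partition_into_squares[of \<mu>, OF \<mu> \<open>0 < \<epsilon>\<close>] by blast
  obtain e where e: "\<And>r. r \<in> T \<Longrightarrow> poly_expr t b (e r) (E r)" using bchoice[OF T(3)[unfolded mem_Collect_eq]] by blast
  define d where "d = 1 - (\<Sum>r\<in>T. (e r)\<^sup>2)"
  define H where "H a = (\<Sum>r\<in>T. (e r)\<^sup>2 * g r a)" for a
  have d: "bounded_by \<epsilon> d"
    unfolding d_def
  proof (rule bounded_by_of_box_bound[OF poly_expr_diff[OF poly_expr_one poly_expr_sum[OF T(1)]]])
    show "poly_expr t b ((e r)\<^sup>2) (\<lambda>x. (E r x)\<^sup>2)" if "r \<in> T" for r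
      by (rule poly_expr_square[OF e[OF that]])
  qed (rule bspec[OF T(4)])
  have H: "bounded_by \<epsilon> (H a)" if a: "a \<in> G" for a
    unfolding H_def
  proof (rule bounded_by_of_box_bound[OF poly_expr_sum[OF T(1)]])
    show "poly_expr t b ((e r)\<^sup>2 * g r a) (\<lambda>x. (E r x)\<^sup>2 * \<gamma> r a x)" if "r \<in> T" for r
      using e[OF that] g a that T(2) by (intro poly_mult poly_expr_square) auto
    fix x assume x: "x \<in> ?B"
    have "\<bar>\<Sum>r\<in>T. (E r x)\<^sup>2 * \<gamma> r a x\<bar> \<le> (\<Sum>r\<in>T. (E r x)\<^sup>2 * \<bar>\<gamma> r a x\<bar>)"
      by (rule order_trans[OF sum_abs]) (simp add: abs_mult)
    also have "\<dots> \<le> (\<Sum>r\<in>T. (E r x)\<^sup>2 * \<mu> r x)"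
      unfolding \<mu>_def using a \<open>finite G\<close> by (intro sum_mono mult_left_mono member_le_sum) auto
    finally show "\<bar>\<Sum>r\<in>T. (E r x)\<^sup>2 * \<gamma> r a x\<bar> < \<epsilon>" using T(5) x by fastforce
  qed
  have "f = d * f + (\<Sum>r\<in>T. (e r)\<^sup>2 * f)"
    unfolding d_def by (simp add: left_diff_distrib sum_distrib_right)
  also have "(\<Sum>r\<in>T. (e r)\<^sup>2 * f) = (\<Sum>r\<in>T. (e r)\<^sup>2 * s r + (\<Sum>a\<in>G. (e r)\<^sup>2 * g r a * a))"
  proof (rule sum.cong[OF refl])
    fix r assume "r \<in> T"
    then have "(e r)\<^sup>2 * f = (e r)\<^sup>2 * (s r + (\<Sum>a\<in>G. g r a * a))" using f[of r] T(2) by auto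
    then show "(e r)\<^sup>2 * f = (e r)\<^sup>2 * s r + (\<Sum>a\<in>G. (e r)\<^sup>2 * g r a * a)"
      by (simp add: distrib_left sum_distrib_left mult.assoc)
  qed
  also have "\<dots> = (\<Sum>r\<in>T. (e r)\<^sup>2 * s r) + (\<Sum>a\<in>G. H a * a)"
    by (simp add: H_def sum.distrib sum_distrib_right sum.swap[of _ G T])
  finally have f_eq: "f = d * f + ((\<Sum>r\<in>T. (e r)\<^sup>2 * s r) + (\<Sum>a\<in>G. H a * a))" .
  have "(\<Sum>r\<in>T. (e r)\<^sup>2 * s r) + ((d * f + \<epsilon> *\<^sub>R (f\<^sup>2 + 1)) + (\<Sum>a\<in>G. H a * a + \<epsilon> *\<^sub>R (a\<^sup>2 + 1))) \<in> N"
    using s T(2) d H by (intro add sumI_finite full absorb_small_multiple \<open>0 < \<epsilon>\<close>) auto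
  also have "(\<Sum>r\<in>T. (e r)\<^sup>2 * s r) + ((d * f + \<epsilon> *\<^sub>R (f\<^sup>2 + 1)) + (\<Sum>a\<in>G. H a * a + \<epsilon> *\<^sub>R (a\<^sup>2 + 1)))
      = (d * f + ((\<Sum>r\<in>T. (e r)\<^sup>2 * s r) + (\<Sum>a\<in>G. H a * a)))
        + \<epsilon> *\<^sub>R ((f\<^sup>2 + 1) + (\<Sum>a\<in>G. a\<^sup>2 + 1))"
    by (simp only: sum.distrib scaleR_sum_right[symmetric] scaleR_right_distrib add_ac)
  finally show ?thesis unfolding f_eq[symmetric] .
qed

end

section \<open>Finitely generated submodules and the ideals of the fibres\<close>

lemma submodule_over_hull: "submodule_over R (submodule_over R hull G)"
  by (rule hull_in) (auto simp: submodule_over_def)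

lemma real_subalgebra_hull: "real_subalgebra (real_subalgebra hull S)"
  by (rule hull_in) (auto simp: real_subalgebra_def subspace_def)

lemma subspace_submodule_over:
  assumes "real_subalgebra R" "submodule_over R W"
  shows "subspace W"
proof -
  have "c *\<^sub>R w \<in> W" if "w \<in> W" for c w
  proof -
    have "c *\<^sub>R 1 \<in> R" using assms(1) unfolding real_subalgebra_def subspace_def by blast
    then have "(c *\<^sub>R 1) * w \<in> W" using assms(2) that unfolding submodule_over_def by blast
    then show ?thesis by simp
  qed
  then show ?thesis using assms(2) unfolding subspace_def submodule_over_def by blast
qed

lemma mem_submodule_hull_imp_combination:
  assumes "real_subalgebra R'" "R \<subseteq> R'" "finite G" "w \<in> submodule_over R hull G"
  obtains p where "\<And>a. a \<in> G \<Longrightarrow> p a \<in> R'" "w = (\<Sum>a\<in>G. p a * a)"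
proof -
  define C where "C = {\<Sum>a\<in>G. p a * a | p. \<forall>a\<in>G. p a \<in> R'}"
  have R': "0 \<in> R'" "1 \<in> R'" "\<And>x y. x \<in> R' \<Longrightarrow> y \<in> R' \<Longrightarrow> x + y \<in> R'"
    "\<And>x y. x \<in> R' \<Longrightarrow> y \<in> R' \<Longrightarrow> x * y \<in> R'"
    using assms(1) unfolding real_subalgebra_def subspace_def by blast+
  have "submodule_over R hull G \<subseteq> C"
  proof (rule hull_minimal)
    show "G \<subseteq> C"
    proof
      fix g assume "g \<in> G"
      have "(\<Sum>a\<in>G. (if a = g then 1 else 0) * a) = (\<Sum>a\<in>G. if a = g then a else 0)"
        by (intro sum.cong) auto
      also have "\<dots> = g" using \<open>g \<in> G\<close> assms(3) by simp
      finally show "g \<in> C" unfolding C_def using R'(1,2)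
        by (intro CollectI exI[of _ "\<lambda>a. if a = g then 1 else 0"]) auto
    qed
    show "submodule_over R C"
      unfolding submodule_over_def
    proof (intro conjI ballI)
      show "0 \<in> C" unfolding C_def using R'(1) by (intro CollectI exI[of _ "\<lambda>_. 0"]) simp
    next
      fix v w assume "v \<in> C" "w \<in> C"
      then obtain p q where "v = (\<Sum>a\<in>G. p a * a)" "\<forall>a\<in>G. p a \<in> R'"
        "w = (\<Sum>a\<in>G. q a * a)" "\<forall>a\<in>G. q a \<in> R'" unfolding C_def by blast
      then show "v + w \<in> C" unfolding C_def using R'(3)
        by (intro CollectI exI[of _ "\<lambda>a. p a + q a"]) (simp add: distrib_right sum.distrib)
    next
      fix c w assume "c \<in> R" "w \<in> C"
      then obtain p where "w = (\<Sum>a\<in>G. p a * a)" "\<forall>a\<in>G. p a \<in> R'" unfolding C_def by blast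
      then show "c * w \<in> C" unfolding C_def using R'(4) \<open>c \<in> R\<close> assms(2)
        by (intro CollectI exI[of _ "\<lambda>a. c * p a"]) (auto simp: sum_distrib_left mult.assoc)
    qed
  qed
  then show thesis using assms(4) that unfolding C_def by blast
qed

text \<open>
  The form needed for gluing: the generators \<open>G\<close> do not vary with \<open>r\<close>, and the coefficients
  vanish at \<open>r\<close> because each carries a factor \<open>b i - r i\<close>.
\<close>

lemma J_sub_eq_combination_vanishing_at:
  assumes "finite G" "W = submodule_over (real_subalgebra hull (b ` {..<t})) hull G"
    and "j \<in> J_sub t b r W"
  obtains g \<gamma> where "\<And>a. a \<in> G \<Longrightarrow> poly_expr t b (g a) (\<gamma> a)" "\<And>a. a \<in> G \<Longrightarrow> \<gamma> a r = 0"
    "j = (\<Sum>a\<in>G. g a * a)"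
proof -
  obtain w where w: "j = (\<Sum>i<t. (b i - r i *\<^sub>R 1) * w i)" "\<And>i. i < t \<Longrightarrow> w i \<in> W"
    using assms(3) unfolding J_sub_def by blast
  have "\<exists>p. (\<forall>a\<in>G. p a \<in> poly_values t b) \<and> w i = (\<Sum>a\<in>G. p a * a)" if "i < t" for i
    using mem_submodule_hull_imp_combination[OF real_subalgebra_poly_values
        real_subalgebra_hull_subset_poly_values assms(1)] w(2)[OF that] unfolding assms(2) by metis
  then obtain p where p: "\<And>i a. i < t \<Longrightarrow> a \<in> G \<Longrightarrow> p i a \<in> poly_values t b"
    "\<And>i. i < t \<Longrightarrow> w i = (\<Sum>a\<in>G. p i a * a)" by metis
  then obtain \<pi> where \<pi>: "\<And>i a. i < t \<Longrightarrow> a \<in> G \<Longrightarrow> poly_expr t b (p i a) (\<pi> i a)"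
    unfolding poly_values_def mem_Collect_eq by metis
  show thesis
  proof
    show "poly_expr t b (\<Sum>i<t. (b i - r i *\<^sub>R 1) * p i a) (\<lambda>x. \<Sum>i<t. (x i - r i) * \<pi> i a x)"
      if "a \<in> G" for a
      using \<pi> that by (intro poly_expr_sum poly_mult poly_expr_diff poly_var poly_const) auto
    show "(\<Sum>i<t. (r i - r i) * \<pi> i a r) = 0" for a by simp
    have "j = (\<Sum>i<t. \<Sum>a\<in>G. (b i - r i *\<^sub>R 1) * p i a * a)"
      unfolding w(1) by (intro sum.cong) (simp_all add: p(2) sum_distrib_left mult.assoc)
    then show "j = (\<Sum>a\<in>G. (\<Sum>i<t. (b i - r i *\<^sub>R 1) * p i a) * a)"
      by (subst (asm) sum.swap) (simp add: sum_distrib_right)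
  qed
qed

lemma quadratic_module_box_module:
  assumes "quadratic_module M"
    and "\<And>i. i < t \<Longrightarrow> u i *\<^sub>R 1 - b i \<in> M" "\<And>i. i < t \<Longrightarrow> b i - l i *\<^sub>R 1 \<in> M"
  shows "box_module t b l u M"
proof
  show "m + n \<in> M" if "m \<in> M" "n \<in> M" for m n
    using set_plus_intro[OF that] assms(1) unfolding quadratic_module_def by blast
qed (use assms in \<open>simp_all add: quadratic_module_def\<close>)

lemma fibre_intersection_subset_seq_closure:
  assumes "quadratic_module M"
    and "\<And>i. i < t \<Longrightarrow> u i *\<^sub>R 1 - b i \<in> M" "\<And>i. i < t \<Longrightarrow> b i - l i *\<^sub>R 1 \<in> M"
    and "fg_submodule (real_subalgebra hull (b ` {..<t})) W"
  shows "(\<Inter>r\<in>param_box t l u. M + J_sub t b r W) \<subseteq> seq_closure M"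
proof
  fix f assume f: "f \<in> (\<Inter>r\<in>param_box t l u. M + J_sub t b r W)"
  interpret box_module t b l u M by (rule quadratic_module_box_module[OF assms(1-3)])
  obtain G where G: "finite G" "W = submodule_over (real_subalgebra hull (b ` {..<t})) hull G"
    using assms(4) unfolding fg_submodule_def by blast
  have fibre: "\<exists>s\<in>M. \<exists>g \<gamma>. (\<forall>a\<in>G. poly_expr t b (g a) (\<gamma> a) \<and> \<gamma> a r = 0) \<and> f = s + (\<Sum>a\<in>G. g a * a)"
    if "r \<in> param_box t l u" for r
  proof -
    have "f \<in> M + J_sub t b r W" using f that by blast
    then obtain s j where "s \<in> M" "j \<in> J_sub t b r W" "f = s + j" by (auto elim: set_plus_elim)
    moreover obtain g \<gamma> where "\<And>a. a \<in> G \<Longrightarrow> poly_expr t b (g a) (\<gamma> a)"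
      "\<And>a. a \<in> G \<Longrightarrow> \<gamma> a r = 0" "j = (\<Sum>a\<in>G. g a * a)"
      using J_sub_eq_combination_vanishing_at[OF G \<open>j \<in> J_sub t b r W\<close>] by blast
    ultimately show ?thesis by blast
  qed
  have "f + \<epsilon> *\<^sub>R ((f\<^sup>2 + 1) + (\<Sum>a\<in>G. a\<^sup>2 + 1)) \<in> M" if "0 < \<epsilon>" for \<epsilon>
    using assms(1) fibre
    by (intro glue_fibres G(1) that) (auto simp: quadratic_module_def)
  then show "f \<in> seq_closure M" unfolding seq_closure_def by blast
qed

section \<open>Uniform stability\<close>

lemma QM_over_snoc_cases:
  assumes "x \<in> QM_over V (fs @ [g])"
  obtains y \<sigma> where "y \<in> QM_over V fs" "\<sigma> \<in> sums_of_squares V" "x = y + \<sigma> * g"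
proof -
  obtain s0 s where s: "s0 \<in> sums_of_squares V" "\<forall>i<Suc (length fs). s i \<in> sums_of_squares V"
    "x = s0 + (\<Sum>i<Suc (length fs). s i * (fs @ [g]) ! i)"
    using assms by (auto simp: QM_over_def)
  have "x = (s0 + (\<Sum>i<length fs. s i * fs ! i)) + s (length fs) * g"
    unfolding s(3) by (simp add: nth_append add.assoc)
  moreover have "s0 + (\<Sum>i<length fs. s i * fs ! i) \<in> QM_over V fs"
    unfolding QM_over_def by (intro CollectI exI[of _ s0] exI[of _ s]) (use s in auto)
  ultimately show thesis using s(2) that by blast
qed

text \<open>
  The two generators \<open>b i - r i\<close> and \<open>- (b i - r i)\<close> contribute \<open>(b i - r i) * (\<sigma> - \<tau>)\<close>, so bounding
  their sums of squares by \<open>V\<close> bounds the ideal part by \<open>W\<close>, independently of \<open>r\<close>.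
\<close>

lemma QM_over_canonical_gens_subset:
  assumes "subspace W" "sums_of_squares V \<subseteq> W"
  shows "QM_over V (canonical_gens fs t b r) \<subseteq> QM fs + J_sub t b r W"
proof (induction t)
  case 0
  have "QM_over V fs \<subseteq> QM fs"
    unfolding QM_def QM_over_def sums_of_squares_def by fast
  then show ?case by (simp add: canonical_gens_def J_sub_def set_plus_def)
next
  case (Suc t)
  let ?g = "b t - r t *\<^sub>R 1"
  show ?case
  proof
    fix x assume "x \<in> QM_over V (canonical_gens fs (Suc t) b r)"
    moreover have "canonical_gens fs (Suc t) b r = (canonical_gens fs t b r @ [?g]) @ [- ?g]"
      by (simp add: canonical_gens_def)
    ultimately obtain z \<tau> where z: "z \<in> QM_over V (canonical_gens fs t b r @ [?g])"
      "\<tau> \<in> sums_of_squares V" "x = z + \<tau> * - ?g"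
      using QM_over_snoc_cases by metis
    obtain y \<sigma> where y: "y \<in> QM_over V (canonical_gens fs t b r)"
      "\<sigma> \<in> sums_of_squares V" "z = y + \<sigma> * ?g"
      using QM_over_snoc_cases[OF z(1)] by metis
    obtain m w where m: "m \<in> QM fs" "\<forall>i<t. w i \<in> W"
      "y = m + (\<Sum>i<t. (b i - r i *\<^sub>R 1) * w i)"
    proof -
      have "y \<in> QM fs + J_sub t b r W" using y(1) Suc.IH by blast
      then obtain m j where "m \<in> QM fs" "j \<in> J_sub t b r W" "y = m + j" by (auto elim: set_plus_elim)
      then show thesis using that unfolding J_sub_def by blast
    qed
    define w' where "w' = w(t := \<sigma> - \<tau>)"
    have "\<sigma> - \<tau> \<in> W" using assms z(2) y(2) subspace_diff by blast
    then have "\<forall>i<Suc t. w' i \<in> W" using m(2) by (simp add: w'_def less_Suc_eq)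
    moreover have "x = m + (\<Sum>i<Suc t. (b i - r i *\<^sub>R 1) * w' i)"
      unfolding z(3) y(3) m(3) by (simp add: w'_def algebra_simps)
    ultimately show "x \<in> QM fs + J_sub (Suc t) b r W"
      using m(1) unfolding J_sub_def by (blast intro: set_plus_intro)
  qed
qed

lemma sums_of_squares_span_subset:
  assumes "subspace W" "\<And>x y. x \<in> B \<Longrightarrow> y \<in> B \<Longrightarrow> x * y \<in> W"
  shows "sums_of_squares (span B) \<subseteq> W"
proof
  have 1: "v * y \<in> W" if "v \<in> span B" "y \<in> B" for v y
    using that(1)
  proof (induction rule: span_induct)
    case base
    show ?case using assms(1) unfolding subspace_def by (auto simp: distrib_right)
  qed (use assms(2) that in blast)
  have 2: "v * w \<in> W" if "v \<in> span B" "w \<in> span B" for v w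
    using that(2)
  proof (induction rule: span_induct)
    case base
    show ?case using assms(1) unfolding subspace_def by (auto simp: distrib_left)
  qed (use 1 that in blast)
  fix \<sigma> assume "\<sigma> \<in> sums_of_squares (span B)"
  then show "\<sigma> \<in> W"
    by (induction rule: sums_of_squares_induct)
       (auto simp: power2_eq_square assms(1) subspace_0 intro: subspace_add[OF assms(1)] 2)
qed

text \<open>
  Uniform stability, applied to the line spanned by \<open>f\<close>, yields one finite-dimensional space
  \<open>span B\<close> for all fibres.  The finitely many products of elements of \<open>B\<close> generate a submodule \<open>W\<close>
  containing all the sums of squares that occur, so the whole algebra may be replaced by \<open>W\<close> in \<open>J\<^sub>r\<close>.
\<close>

lemma fibrewise_member_in_seq_closure:
  assumes "quadratic_module M"
    and "\<And>i. i < t \<Longrightarrow> u i *\<^sub>R 1 - b i \<in> M" "\<And>i. i < t \<Longrightarrow> b i - l i *\<^sub>R 1 \<in> M"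
    and M: "M = QM fs"
    and stable: "\<And>r. r \<in> param_box t l u \<Longrightarrow> stability_map (canonical_gens fs t b r) \<Phi>"
    and f: "\<And>r. r \<in> param_box t l u \<Longrightarrow> f \<in> M + J_sub t b r UNIV"
  shows "f \<in> seq_closure M"
proof (cases "param_box t l u = {}")
  case True
  have "fg_submodule (real_subalgebra hull (b ` {..<t})) (submodule_over (real_subalgebra hull (b ` {..<t})) hull {})"
    unfolding fg_submodule_def by (intro exI[of _ "{}"]) simp
  then show ?thesis using fibre_intersection_subset_seq_closure[OF assms(1-3)] True by fastforce
next
  case False
  let ?R = "real_subalgebra hull (b ` {..<t})"
  have U: "fin_dim_subspace (span {f})" unfolding fin_dim_subspace_def by blast
  obtain B where B: "finite B" "\<Phi> (span {f}) = span B"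
  proof -
    obtain r where "r \<in> param_box t l u" using False by blast
    then have "fin_dim_subspace (\<Phi> (span {f}))" using stable U unfolding stability_map_def by blast
    then show thesis using that unfolding fin_dim_subspace_def by blast
  qed
  define W where "W = submodule_over ?R hull ((\<lambda>(x, y). x * y) ` (B \<times> B))"
  have fg: "fg_submodule ?R W"
    unfolding fg_submodule_def W_def
    using B(1) by (intro exI[of _ "(\<lambda>(x, y). x * y) ` (B \<times> B)"]) simp
  have sub: "subspace W"
    unfolding W_def by (rule subspace_submodule_over[OF real_subalgebra_hull submodule_over_hull])
  have "x * y \<in> W" if "x \<in> B" "y \<in> B" for x y
    unfolding W_def using that by (intro hull_inc) auto
  then have sos: "sums_of_squares (\<Phi> (span {f})) \<subseteq> W"
    unfolding B(2) by (rule sums_of_squares_span_subset[OF sub])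
  have "f \<in> M + J_sub t b r W" if r: "r \<in> param_box t l u" for r
  proof -
    have "f \<in> QM (canonical_gens fs t b r) \<inter> span {f}"
      using f[OF r] unfolding M QM_canonical_gens by (simp add: span_base)
    then have "f \<in> QM_over (\<Phi> (span {f})) (canonical_gens fs t b r)"
      using stable[OF r] U unfolding stability_map_def by blast
    then show ?thesis using QM_over_canonical_gens_subset[OF sub sos] unfolding M by blast
  qed
  then show ?thesis using fibre_intersection_subset_seq_closure[OF assms(1-3) fg] by blast
qed

section \<open>Closures and saturation\<close>

lemma seq_closure_subset_double_dual: "seq_closure M \<subseteq> double_dual M"
proof
  fix f assume "f \<in> seq_closure M"
  then obtain q where q: "\<And>\<epsilon>. 0 < \<epsilon> \<Longrightarrow> f + \<epsilon> *\<^sub>R q \<in> M" unfolding seq_closure_def by blast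
  have "0 \<le> L f" if L: "linear L" "\<forall>m\<in>M. 0 \<le> L m" for L :: "'a \<Rightarrow> real"
  proof (rule field_le_epsilon)
    fix \<epsilon> :: real assume "0 < \<epsilon>"
    define \<delta> where "\<delta> = \<epsilon> / (\<bar>L q\<bar> + 1)"
    have "0 < \<delta>" unfolding \<delta>_def using \<open>0 < \<epsilon>\<close> by simp
    then have "0 \<le> L (f + \<delta> *\<^sub>R q)" using q L(2) by blast
    also have "\<dots> = L f + \<delta> * L q" using L(1) by (simp add: linear_add linear_scale)
    also have "\<delta> * L q \<le> \<delta> * (\<bar>L q\<bar> + 1)" using \<open>0 < \<delta>\<close> by (intro mult_left_mono) auto
    also have "\<delta> * (\<bar>L q\<bar> + 1) = \<epsilon>" unfolding \<delta>_def by simp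
    finally show "0 \<le> L f + \<epsilon>" by simp
  qed
  then show "f \<in> double_dual M" unfolding double_dual_def by blast
qed

lemma double_dual_subset_Pos_on: "double_dual M \<subseteq> Pos_on (nonneg_characters M)"
  unfolding double_dual_def Pos_on_def nonneg_characters_def real_characters_def by blast

lemma double_dual_mono: "M \<subseteq> N \<Longrightarrow> double_dual M \<subseteq> double_dual N"
  unfolding double_dual_def by blast

lemma Pos_on_nonneg_characters_mono:
  "M \<subseteq> N \<Longrightarrow> Pos_on (nonneg_characters M) \<subseteq> Pos_on (nonneg_characters N)"
  unfolding Pos_on_def nonneg_characters_def by blast

lemma subset_plus_J_sub: "M \<subseteq> M + J_sub t b r UNIV"
proof
  fix m assume "m \<in> M"
  moreover have "0 \<in> J_sub t b r UNIV"
    unfolding J_sub_def by (intro CollectI exI[of _ "\<lambda>_. 0"]) simp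
  ultimately have "m + 0 \<in> M + J_sub t b r UNIV" by (rule set_plus_intro)
  then show "m \<in> M + J_sub t b r UNIV" by simp
qed

theorem theorem4p3:
  fixes M :: "'a::{real_algebra,comm_ring,comm_monoid_mult} set"
    and t :: nat and b :: "nat \<Rightarrow> 'a" and l u :: "nat \<Rightarrow> real"
  assumes "quadratic_module M"
    and "\<And>i. i < t \<Longrightarrow> l i \<le> u i"
    and "\<And>i. i < t \<Longrightarrow> u i *\<^sub>R 1 - b i \<in> M"
    and "\<And>i. i < t \<Longrightarrow> b i - l i *\<^sub>R 1 \<in> M"
  shows "(\<forall>W. fg_submodule (real_subalgebra hull (b ` {..<t})) W \<longrightarrow>
            (\<Inter>r\<in>param_box t l u. M + J_sub t b r W) \<subseteq> seq_closure M) \<and>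
         (\<forall>fs. M = QM fs \<longrightarrow>
            (\<forall>r\<in>param_box t l u. closed_qm (M + J_sub t b r UNIV)) \<longrightarrow>
            (\<exists>\<Phi>. \<forall>r\<in>param_box t l u. stability_map (canonical_gens fs t b r) \<Phi>) \<longrightarrow>
            seq_closure M = double_dual M) \<and>
         (\<forall>fs. M = QM fs \<longrightarrow>
            (\<forall>r\<in>param_box t l u. saturated_qm (M + J_sub t b r UNIV)) \<longrightarrow>
            (\<exists>\<Phi>. \<forall>r\<in>param_box t l u. stability_map (canonical_gens fs t b r) \<Phi>) \<longrightarrow>
            ddagger_property M)"
proof (intro conjI allI impI)
  fix W assume "fg_submodule (real_subalgebra hull (b ` {..<t})) W"
  from fibre_intersection_subset_seq_closure[OF assms(1,3,4) this]
  show "(\<Inter>r\<in>param_box t l u. M + J_sub t b r W) \<subseteq> seq_closure M" .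
next
  fix fs
  assume M: "M = QM fs"
    and closed: "\<forall>r\<in>param_box t l u. closed_qm (M + J_sub t b r UNIV)"
    and "\<exists>\<Phi>. \<forall>r\<in>param_box t l u. stability_map (canonical_gens fs t b r) \<Phi>"
  then obtain \<Phi> where stable: "\<And>r. r \<in> param_box t l u \<Longrightarrow> stability_map (canonical_gens fs t b r) \<Phi>"
    by blast
  have "f \<in> seq_closure M" if f: "f \<in> double_dual M" for f
  proof (rule fibrewise_member_in_seq_closure[OF assms(1,3,4) M stable])
    fix r assume "r \<in> param_box t l u"
    then show "f \<in> M + J_sub t b r UNIV"
      using f closed double_dual_mono[OF subset_plus_J_sub[of M t b r]] unfolding closed_qm_def by blast
  qed
  then show "seq_closure M = double_dual M"
    using seq_closure_subset_double_dual by blast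
next
  fix fs
  assume M: "M = QM fs"
    and saturated: "\<forall>r\<in>param_box t l u. saturated_qm (M + J_sub t b r UNIV)"
    and "\<exists>\<Phi>. \<forall>r\<in>param_box t l u. stability_map (canonical_gens fs t b r) \<Phi>"
  then obtain \<Phi> where stable: "\<And>r. r \<in> param_box t l u \<Longrightarrow> stability_map (canonical_gens fs t b r) \<Phi>"
    by blast
  have "f \<in> seq_closure M" if f: "f \<in> Pos_on (nonneg_characters M)" for f
  proof (rule fibrewise_member_in_seq_closure[OF assms(1,3,4) M stable])
    fix r assume "r \<in> param_box t l u"
    then show "f \<in> M + J_sub t b r UNIV"
      using f saturated Pos_on_nonneg_characters_mono[OF subset_plus_J_sub[of M t b r]]
      unfolding saturated_qm_def by blast
  qed
  then show "ddagger_property M"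
    unfolding ddagger_property_def
    using seq_closure_subset_double_dual double_dual_subset_Pos_on by blast
qed

end
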